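(* Let $m$ and $q$ be positive integers and let $g:\mathbb{Z}\to\mathbb{C}$ be periodic of period $m$. Let $M(g)=\frac1m\sum_{n=0}^{m-1}g(n)$ and $L(s,g)=\sum_{n=1}^\infty g(n)n^{-s}$. If $\alpha$ and $\beta$ are positive real numbers satisfying $\alpha\beta=\pi^2$, then \[ \alpha^{-q+1/2}\bigg\{\tfrac12 L(2q,g) + \sum_{n=1}^\infty \frac{n^{-2q}g(n)}{e^{2n\alpha}-1}\bigg\} = \tfrac12 (-1)^q \beta^{-q+1/2} m^{-1} \sum_{k=1}^{m-1} g(k)\sin(2\pi k/m) \sum_{n=1}^\infty \frac{n^{-2q}}{\cosh(2n\beta/m)-\cos(2\pi k/m)} + \sum_{j=0}^q (-1)^{j+1}\alpha^{j-1/2-q}\beta^{-j}\zeta(2j)L(2q-2j+1,g) \] if $g$ is odd, and \[ \alpha^{-q}\bigg\{\tfrac12 L(2q+1,g)+\sum_{n=1}^{\infty} \frac{n^{-2q-1}g(n)}{e^{2n\alpha}-1}\bigg\} = \tfrac12 (-\beta)^{-q} m^{-1}\sum_{k=0}^{m-1}g(k) \sum_{n=1}^\infty \bigg(\frac{\cos(2\pi k/m)-\exp(-2n\beta/m)} {\cosh(2n\beta/m)-\cos(2\pi k/m)}\bigg)n^{-2q-1} +\tfrac12 (-\beta)^{-q}M(g)\zeta(2q+1) + \sum_{j=0}^{q+1} (-1)^{j+1}\alpha^{j-q-1}\beta^{-j}\zeta(2j)L(2q-2j+2,g) \] if $g$ is even. If $M(g)=0$, the latter formula (for even $g$) is also valid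 when $q=0$, with the term $\tfrac12 M(g)\zeta(1)$ interpreted as $0$.
   Context: $\zeta$ denotes the Riemann zeta function, with $\zeta(0)=-\tfrac12$. The series $L(s,g)$ converges for $\Re(s)>1$, and for $\Re(s)>0$ when $M(g)=0$ (in particular whenever $g$ is odd); for odd $g$ the value $L(1,g)$ is given by the convergent series. For even $g$, $L(0,g)$ denotes the value at $s=0$ of the meromorphic continuation of $L(s,g)$, namely $L(0,g)=-\tfrac12 g(0)$. *)

theory Defs
  imports "HOL-Complex_Analysis.Complex_Analysis"
begin

(* The summation index n ranges over the positive integers, written Suc n. *)
definition dirichlet_term :: "complex \<Rightarrow> (int \<Rightarrow> complex) \<Rightarrow> nat \<Rightarrow> complex" where
  "dirichlet_term s g n = g (int (Suc n)) * of_nat (Suc n) powr (- s)"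

(* Meromorphic continuation, from the half-plane Re w > 1, of the sum of the series.  By the
   identity theorem the value at s does not depend on the half-plane Re w > c or on f;
   "nicely" excludes arbitrary values at isolated points (and fixes the value 0 at poles). *)
definition dirichlet_continuation :: "complex \<Rightarrow> (int \<Rightarrow> complex) \<Rightarrow> complex" where
  "dirichlet_continuation s g =
     (THE v. \<exists>c f. c < Re s \<and> f nicely_meromorphic_on {w. c < Re w} \<and>
                   (\<forall>w. 1 < Re w \<longrightarrow> f w = (\<Sum>n. dirichlet_term w g n)) \<and> v = f s)"

(* L(s,g): the value of the series wherever it converges (possibly only conditionally, as at
   s = 1 for odd g), and the value of the continuation elsewhere. *)
definition dirichlet_L :: "complex \<Rightarrow> (int \<Rightarrow> complex) \<Rightarrow> complex" where
  "dirichlet_L s g =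
     (if summable (dirichlet_term s g) then \<Sum>n. dirichlet_term s g n
      else dirichlet_continuation s g)"

definition zeta :: "complex \<Rightarrow> complex" where
  "zeta s = dirichlet_L s (\<lambda>_. 1)"

definition period_mean :: "nat \<Rightarrow> (int \<Rightarrow> complex) \<Rightarrow> complex" where
  "period_mean m g = (\<Sum>n<m. g (int n)) / of_nat m"

end

theory Submission
  imports Defs "HOL-Real_Asymp.Real_Asymp"
begin

text \<open>
  The left-hand side is a sum of \<open>g n\<close> times a power of \<open>n\<close> times \<open>coth (n \<alpha>) / 2\<close>. Expand coth into
  partial fractions with denominators \<open>n\<^sup>2 \<alpha>\<^sup>2 + \<pi>\<^sup>2 k\<^sup>2\<close> and apply \<open>q\<close> steps of the geometric series to
  each of them: the polynomial part gives the products of values of \<open>\<zeta>\<close> and \<open>L\<close>, and the remainder is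
  a double series with weights \<open>k\<close> to the power \<open>- 2 q\<close>. Its order of summation may be exchanged by
  dominated convergence, using summation by parts when the series over \<open>n\<close> converges only
  conditionally. The inner sum over \<open>n\<close> is then evaluated residue class by residue class modulo \<open>m\<close>
  with the partial fractions of the cotangent; for even \<open>g\<close> the summand at \<open>n = 0\<close> that this evaluation
  includes accounts for the term with \<open>L(0, g) = - g 0 / 2\<close>. That value comes from continuing \<open>L\<close> past
  the line \<open>Re s = 0\<close> with the trapezoidal rule.
\<close>

section \<open>Partial fractions of the cotangent\<close>

text \<open>The parameter \<beta> enters through the poles: in \<open>n\<close> the denominators
  vanish at \<open>n = i y\<close> and \<open>n = - i y\<close> with
  \<open>y = pi * k / \<alpha>\<close>, and the closed form of the inner sum depends on
  \<open>2 * pi * y / m\<close>, which equals \<open>2 * k * \<beta> / m\<close> because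
  \<alpha>\<beta> = pi^2. Two terms of the formulas do not come from the geometric series. The
  summand \<open>j = 0\<close> is the polar part \<open>1 / (2 * x)\<close> in the expansion of
  \<open>coth x / 2\<close>, rewritten with \<open>zeta 0 = - 1 / 2\<close>. The term with
  \<open>M(g)\<close> is the constant 1 in
  \<open>sinh X / (cosh X - cos \<theta>) = 1 + ...\<close>; summed against \<open>k\<close> to the
  power \<open>- 2 q - 1\<close> it gives \<open>zeta (2 q + 1)\<close>, which is why
  \<open>q = 0\<close> demands \<open>M(g) = 0\<close>. The obstacle is a bound for the partial sums
  over \<open>n\<close> that is uniform in their length and summable over \<open>k\<close>. For
  \<open>q > 0\<close> a bound independent of \<open>k\<close> is enough; for \<open>q = 0\<close>
  the weight in \<open>k\<close> is lost and the decay has to come from the denominators.\<close>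

lemma cot_partial_fractions:
  fixes z :: complex
  assumes "z \<notin> \<int>"
  shows "(\<lambda>l. 1 / (z + of_nat l) - 1 / (1 - z + of_nat l)) sums (of_real pi * cot (of_real pi * z))"
proof -
  have z: "z \<notin> \<int>\<^sub>\<le>\<^sub>0" and z': "1 - z \<notin> \<int>\<^sub>\<le>\<^sub>0"
    using assms nonpos_Ints_Int[of "1 - z"] Ints_diff[of 1 "1 - z"] nonpos_Ints_Int[of z] by auto
  have ser: "(\<lambda>k. inverse (of_nat (Suc k)) - inverse (w + of_nat k)) sums (Digamma w + euler_mascheroni)"
    if "w \<noteq> 0" for w :: complex
    using summable_sums[OF summable_Digamma[OF that]] by (simp add: Digamma_def)
  have 1: "(\<lambda>l. 1 / (z + of_nat l) - 1 / (1 - z + of_nat l)) sums (Digamma (1 - z) - Digamma z)"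
  proof -
    have "z \<noteq> 0" "1 - z \<noteq> 0" using z z' by auto
    then show ?thesis
      using sums_diff[OF ser[of "1 - z"] ser[of z]] by (simp add: inverse_eq_divide)
  qed
  \<comment> \<open>Differentiating both sides of the reflection formula
    \<open>rGamma z * rGamma (1 - z) = sin (pi * z) / pi\<close> yields the reflection formula of
    the digamma function, hence the cotangent.\<close>
  have "((\<lambda>z. rGamma z * rGamma (1 - z)) has_field_derivative
      rGamma z * rGamma (1 - z) * (Digamma (1 - z) - Digamma z)) (at z)"
    using z z' by (auto intro!: derivative_eq_intros simp: algebra_simps)
  moreover have "((\<lambda>z. sin (of_real pi * z) / of_real pi) has_field_derivative cos (of_real pi * z)) (at z)"
    by (auto intro!: derivative_eq_intros)
  ultimately have "rGamma z * rGamma (1 - z) * (Digamma (1 - z) - Digamma z) = cos (of_real pi * z)"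
    unfolding rGamma_reflection_complex by (rule DERIV_unique)
  moreover have "rGamma z * rGamma (1 - z) \<noteq> 0"
    using z z' by (simp add: rGamma_eq_zero_iff)
  ultimately have "Digamma (1 - z) - Digamma z = of_real pi * cot (of_real pi * z)"
    unfolding rGamma_reflection_complex by (simp add: cot_def field_simps)
  with 1 show ?thesis by simp
qed

lemma cot_add_eq:
  fixes z w :: "'a::{real_normed_field,banach}"
  assumes "sin z \<noteq> 0" "sin w \<noteq> 0"
  shows "cot z + cot w = sin (z + w) / (sin z * sin w)"
  using assms by (simp add: cot_def sin_add field_simps)

lemma cot_diff_eq:
  fixes z w :: "'a::{real_normed_field,banach}"
  assumes "sin z \<noteq> 0" "sin w \<noteq> 0"
  shows "cot w - cot z = sin (z - w) / (sin z * sin w)"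
  using assms by (simp add: cot_def sin_diff field_simps)

section \<open>Symmetric sums of periodic coefficients, split by residue class\<close>

lemma periodic_add_mult:
  fixes g :: "int \<Rightarrow> 'a"
  assumes "\<And>n. g (n + int m) = g n"
  shows "g (n + j * int m) = g n"
proof -
  have pos: "g (n + int k * int m) = g n" for k n
  proof (induction k)
    case (Suc k)
    then show ?case using assms[of "n + int k * int m"] by (simp add: algebra_simps)
  qed simp
  show ?thesis
  proof (cases "j \<ge> 0")
    case True
    then show ?thesis using pos[of n "nat j"] by simp
  next
    case False
    then show ?thesis using pos[of "n + j * int m" "nat (- j)"] by simp
  qed
qed

lemma sum_lessThan_mult:
  fixes h :: "nat \<Rightarrow> 'a::comm_monoid_add"
  shows "(\<Sum>n<K*m. h n) = (\<Sum>l<K. \<Sum>r<m. h (l * m + r))"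
  unfolding sum.nat_group[symmetric]
proof (rule sum.cong[OF refl])
  fix l
  show "sum h {l * m..<l * m + m} = (\<Sum>r<m. h (l * m + r))"
    using sum.shift_bounds_nat_ivl[of h 0 "l * m" m] by (simp add: lessThan_atLeast0 add.commute)
qed

text \<open>Pairing \<open>n\<close> with \<open>- n - 1\<close> instead of \<open>- n\<close> makes
  the range from \<open>- K * m\<close> to \<open>K * m - 1\<close> a disjoint union of complete
  residue systems. It is also the pairing of the cotangent series, since
  \<open>- (1 - z + l) = z - (l + 1)\<close>.\<close>

lemma symmetric_block_sum:
  fixes g \<phi> :: "int \<Rightarrow> 'a::comm_ring_1"
  assumes per: "\<And>n. g (n + int m) = g n"
  shows "(\<Sum>n<K*m. g (int n) * \<phi> (int n) + g (- int n - 1) * \<phi> (- int n - 1))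
    = (\<Sum>r<m. g (int r) * (\<Sum>l<K. \<phi> (int r + int l * int m) + \<phi> (int r - (int l + 1) * int m)))"
proof -
  note p = periodic_add_mult[of g, OF per]
  have block: "(\<Sum>n<K*m. h n) = (\<Sum>l<K. \<Sum>r<m. h (r + l * m))" for h :: "nat \<Rightarrow> 'a"
    unfolding sum_lessThan_mult by (simp add: add.commute)
  have "(\<Sum>n<K*m. g (int n) * \<phi> (int n)) = (\<Sum>l<K. \<Sum>r<m. g (int r) * \<phi> (int r + int l * int m))"
    unfolding block using p[of "int r" "int l" for r l] by (intro sum.cong refl) (simp add: algebra_simps)
  moreover have "(\<Sum>n<K*m. g (- int n - 1) * \<phi> (- int n - 1))
      = (\<Sum>l<K. \<Sum>r<m. g (int r) * \<phi> (int r - (int l + 1) * int m))"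
    unfolding block
  proof (rule sum.cong[OF refl])
    \<comment> \<open>Reversing the order inside a block of negative indices brings them to the form
      \<open>r - (l + 1) * m\<close> with \<open>r\<close> increasing.\<close>
    fix l
    have "(\<Sum>r<m. g (- int (r + l * m) - 1) * \<phi> (- int (r + l * m) - 1))
      = (\<Sum>r<m. g (- int (m - Suc r + l * m) - 1) * \<phi> (- int (m - Suc r + l * m) - 1))"
      by (rule sum.nat_diff_reindex[symmetric])
    also have "\<dots> = (\<Sum>r<m. g (int r) * \<phi> (int r - (int l + 1) * int m))"
    proof (intro sum.cong refl)
      fix r assume "r \<in> {..<m}"
      then have "- int (m - Suc r + l * m) - 1 = int r + (- int l - 1) * int m"
        by (simp add: of_nat_diff algebra_simps)
      moreover have "int r + (- int l - 1) * int m = int r - (int l + 1) * int m"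
        by (simp add: algebra_simps)
      ultimately show "g (- int (m - Suc r + l * m) - 1) * \<phi> (- int (m - Suc r + l * m) - 1)
          = g (int r) * \<phi> (int r - (int l + 1) * int m)"
        by (metis p)
    qed
    finally show "(\<Sum>r<m. g (- int (r + l * m) - 1) * \<phi> (- int (r + l * m) - 1))
      = (\<Sum>r<m. g (int r) * \<phi> (int r - (int l + 1) * int m))" .
  qed
  moreover have "(\<Sum>l<K. \<Sum>r<m. F l r) = (\<Sum>r<m. \<Sum>l<K. F l r)" for F :: "nat \<Rightarrow> nat \<Rightarrow> 'a"
    by (rule sum.swap)
  ultimately show ?thesis
    unfolding sum.distrib sum_distrib_left distrib_left by simp
qed

text \<open>Evenness is asked of the product, so that both factors may be even or both odd. The sum
  from \<open>- K * m\<close> to \<open>K * m - 1\<close> is then twice the sum from 1 to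
  \<open>K * m\<close>, plus the value at 0, minus the value at \<open>K * m\<close>; this last one
  is \<open>g 0 * \<phi> (K * m)\<close> and tends to 0.\<close>

lemma periodic_sum_by_residues:
  fixes g \<phi> :: "int \<Rightarrow> complex"
  assumes m: "m > 0" and per: "\<And>n. g (n + int m) = g n"
    and even: "\<And>n. g (- n) * \<phi> (- n) = g n * \<phi> n"
    and lim: "(\<lambda>n. \<phi> (int n)) \<longlonglongrightarrow> 0"
    and sums: "\<And>r. r < m \<Longrightarrow>
      (\<lambda>l. \<phi> (int r + int l * int m) + \<phi> (int r - (int l + 1) * int m)) sums \<Phi> r"
    and summ: "summable (\<lambda>n. g (int (Suc n)) * \<phi> (int (Suc n)))"
  shows "(\<lambda>n. g (int (Suc n)) * \<phi> (int (Suc n))) sums (((\<Sum>r<m. g (int r) * \<Phi> r) - g 0 * \<phi> 0) / 2)"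
proof -
  define h where "h n = g (int n) * \<phi> (int n)" for n
  have "(\<lambda>K. \<Sum>r<m. g (int r) * (\<Sum>l<K. \<phi> (int r + int l * int m) + \<phi> (int r - (int l + 1) * int m)))
      \<longlonglongrightarrow> (\<Sum>r<m. g (int r) * \<Phi> r)"
    using sums by (intro tendsto_intros) (auto simp: sums_def)
  moreover have "(\<Sum>r<m. g (int r) * (\<Sum>l<K. \<phi> (int r + int l * int m) + \<phi> (int r - (int l + 1) * int m)))
     = 2 * (\<Sum>n<K*m. h (Suc n)) + h 0 - h (K * m)" for K
  proof -
    have "(\<Sum>r<m. g (int r) * (\<Sum>l<K. \<phi> (int r + int l * int m) + \<phi> (int r - (int l + 1) * int m)))
       = (\<Sum>n<K*m. h n + h (Suc n))"
      unfolding symmetric_block_sum[of g m, OF per, symmetric]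
    proof (intro sum.cong refl)
      fix n
      have "- int n - 1 = - int (Suc n)" by simp
      then show "g (int n) * \<phi> (int n) + g (- int n - 1) * \<phi> (- int n - 1) = h n + h (Suc n)"
        by (simp only: h_def even)
    qed
    also have "(\<Sum>n<K*m. h n) = (\<Sum>n<K*m. h (Suc n)) + h 0 - h (K * m)"
      using trans[OF sum.lessThan_Suc[symmetric] sum.lessThan_Suc_shift, of h "K * m"]
      by (simp add: eq_diff_eq add.commute)
    then have "(\<Sum>n<K*m. h n + h (Suc n)) = 2 * (\<Sum>n<K*m. h (Suc n)) + h 0 - h (K * m)"
      by (simp add: sum.distrib)
    finally show ?thesis .
  qed
  moreover have sub: "strict_mono (\<lambda>K. K * m)"
    using m by (simp add: strict_mono_def)
  have "(\<lambda>K. h (K * m)) = (\<lambda>K. g 0 * \<phi> (int (K * m)))"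
    using periodic_add_mult[of g m 0, OF per] by (auto simp: h_def)
  then have "(\<lambda>K. h (K * m)) \<longlonglongrightarrow> 0"
    using tendsto_mult_right_zero[OF LIMSEQ_subseq_LIMSEQ[OF lim sub, unfolded o_def]] by simp
  \<comment> \<open>The blocks see only partial sums whose length is a multiple of \<open>m\<close>;
    summability of the whole series identifies their limit.\<close>
  moreover have "(\<lambda>K. \<Sum>n<K*m. h (Suc n)) \<longlonglongrightarrow> (\<Sum>n. h (Suc n))"
    using LIMSEQ_subseq_LIMSEQ[OF summable_LIMSEQ sub, of "\<lambda>n. h (Suc n)"] summ
    by (simp add: o_def h_def)
  then have "(\<lambda>K. 2 * (\<Sum>n<K*m. h (Suc n)) + h 0 - h (K * m)) \<longlonglongrightarrow> 2 * (\<Sum>n. h (Suc n)) + h 0 - 0"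
    using calculation(3) by (intro tendsto_intros)
  ultimately have "2 * (\<Sum>n. h (Suc n)) + h 0 - 0 = (\<Sum>r<m. g (int r) * \<Phi> r)"
    using LIMSEQ_unique by auto
  then have "(\<Sum>n. h (Suc n)) = ((\<Sum>r<m. g (int r) * \<Phi> r) - h 0) / 2"
    by (simp add: eq_divide_eq eq_diff_eq mult.commute)
  then show ?thesis
    using summable_sums[OF summ] unfolding h_def by (simp only: of_nat_0)
qed

section \<open>Closed forms of the sums over one residue class\<close>

lemma shifted_reciprocal_sums:
  fixes y :: real and r :: nat
  assumes m: "m > 0" and y: "y \<noteq> 0"
  defines "z \<equiv> Complex (real r) y / of_nat m"
  shows "(\<lambda>l. 1 / Complex (real_of_int (int r + int l * int m)) y
            + 1 / Complex (real_of_int (int r - (int l + 1) * int m)) y)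
    sums (of_real (pi / real m) * cot (of_real pi * z))"
    and "sin (of_real pi * z) \<noteq> 0"
proof -
  have im: "Im z = y / real m" by (simp add: z_def)
  then have z: "z \<notin> \<int>"
    using m y by (auto elim!: Ints_cases)
  show "sin (of_real pi * z) \<noteq> 0"
  proof
    assume "sin (of_real pi * z) = 0"
    then obtain x where "of_real pi * z = of_real (real_of_int x * pi)"
      by (auto simp: sin_eq_0)
    then have "Im (of_real pi * z) = 0"
      by (simp only: Im_complex_of_real)
    then show False using im m y by simp
  qed
  have "1 / of_nat m * (1 / (z + of_nat l) - 1 / (1 - z + of_nat l))
     = 1 / Complex (real_of_int (int r + int l * int m)) y
            + 1 / Complex (real_of_int (int r - (int l + 1) * int m)) y" for l
  proof -
    have "of_nat m * (z + of_nat l) = Complex (real_of_int (int r + int l * int m)) y"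
      using m by (simp add: z_def complex_eq_iff field_simps)
    moreover have "of_nat m * (1 - z + of_nat l) = - Complex (real_of_int (int r - (int l + 1) * int m)) y"
      using m by (simp add: z_def complex_eq_iff field_simps)
    ultimately show ?thesis
      by (simp add: diff_divide_distrib[symmetric] right_diff_distrib)
  qed
  then show "(\<lambda>l. 1 / Complex (real_of_int (int r + int l * int m)) y
            + 1 / Complex (real_of_int (int r - (int l + 1) * int m)) y)
    sums (of_real (pi / real m) * cot (of_real pi * z))"
    using sums_mult[OF cot_partial_fractions[OF z], of "1 / of_nat m"] by simp
qed

text \<open>Splitting the kernels into \<open>1 / (n + i y)\<close> and \<open>1 / (n - i y)\<close>
  gives cotangents at two conjugate points \<open>z\<close> and \<open>w\<close> with
  \<open>z + w = \<theta>\<close> and \<open>z - w = i X\<close>. Hence the sum of the cotangents is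
  trigonometric in \<theta>, their difference hyperbolic in \<open>X\<close>, and both have the
  denominator \<open>sin z * sin w = (cosh X - cos \<theta>) / 2\<close>.\<close>

lemma
  fixes y :: real and r :: nat
  assumes m: "m > 0" and y: "y > 0"
  defines "X \<equiv> 2 * pi * y / real m" and "\<theta> \<equiv> 2 * pi * real r / real m"
  shows sums_residue_class_odd: 
    "(\<lambda>l. (\<lambda>n. complex_of_int n / of_real (of_int n ^ 2 + y\<^sup>2)) (int r + int l * int m)
        + (\<lambda>n. complex_of_int n / of_real (of_int n ^ 2 + y\<^sup>2)) (int r - (int l + 1) * int m))
      sums of_real (pi / real m * (sin \<theta> / (cosh X - cos \<theta>)))" (is ?odd)
    and sums_residue_class_even:
    "(\<lambda>l. (\<lambda>n. 1 / complex_of_real (of_int n ^ 2 + y\<^sup>2)) (int r + int l * int m)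
        + (\<lambda>n. 1 / complex_of_real (of_int n ^ 2 + y\<^sup>2)) (int r - (int l + 1) * int m))
      sums of_real (pi / (real m * y) * (sinh X / (cosh X - cos \<theta>)))" (is ?even)
proof -
  define z w where "z = of_real pi * (Complex (real r) y / of_nat m)"
    and "w = of_real pi * (Complex (real r) (-y) / of_nat m)"
  have nz: "sin z \<noteq> 0" "sin w \<noteq> 0"
    using shifted_reciprocal_sums(2)[of m y r] shifted_reciprocal_sums(2)[of m "-y" r] m y
    by (auto simp: z_def w_def)
  have zw: "z + w = of_real \<theta>" "z - w = \<i> * of_real X"
    by (auto simp: z_def w_def \<theta>_def X_def complex_eq_iff field_simps)
  have hyp: "cosh (complex_of_real x) = of_real (cosh x)" "sinh (complex_of_real x) = of_real (sinh x)" for x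
    by (simp_all add: cosh_def sinh_def scaleR_conv_of_real flip: exp_of_real)
  have prod: "sin z * sin w = of_real (cosh X - cos \<theta>) / 2"
    by (simp add: sin_times_sin zw cosh_conv_cos[symmetric] hyp cos_of_real)
  then have nz': "cosh X - cos \<theta> \<noteq> 0"
    using nz by auto
  have add: "cot z + cot w = of_real (2 * (sin \<theta> / (cosh X - cos \<theta>)))"
    unfolding cot_add_eq[OF nz] prod zw using nz' by (simp add: sin_of_real)
  have diff: "cot w - cot z = 2 * \<i> * of_real (sinh X / (cosh X - cos \<theta>))"
    unfolding cot_diff_eq[OF nz] prod zw using nz'
    using sinh_conv_sin[of "of_real X"] by (simp add: hyp field_simps)
  define P Q where "P n = 1 / Complex (of_int n) y" and "Q n = 1 / Complex (of_int n) (- y)" for n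
  have s: "(\<lambda>l. P (int r + int l * int m) + P (int r - (int l + 1) * int m)) sums (of_real (pi / real m) * cot z)"
    "(\<lambda>l. Q (int r + int l * int m) + Q (int r - (int l + 1) * int m)) sums (of_real (pi / real m) * cot w)"
    using shifted_reciprocal_sums(1)[of m y r] shifted_reciprocal_sums(1)[of m "-y" r] m y
    unfolding z_def w_def P_def Q_def by auto
  have cplx: "Complex a y \<noteq> 0" "Complex a (-y) \<noteq> 0" 
     "Complex a y * Complex a (-y) = of_real (a\<^sup>2 + y\<^sup>2)" for a
    using y by (auto simp: complex_eq_iff power2_eq_square)
  have inv: "1 / Complex a y = Complex a (-y) / of_real (a\<^sup>2 + y\<^sup>2)"
     "1 / Complex a (-y) = Complex a y / of_real (a\<^sup>2 + y\<^sup>2)" for a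
    using cplx(1,2)[of a] unfolding cplx(3)[symmetric] by (simp_all add: field_simps)
  have "Complex a (-y) + Complex a y = 2 * of_real a" for a
    by (simp add: complex_eq_iff)
  then have e1: "1/2 * (1 / Complex a y + 1 / Complex a (-y)) = of_real a / of_real (a\<^sup>2 + y\<^sup>2)" for a
    unfolding inv add_divide_distrib[symmetric] by simp
  have "Complex a y - Complex a (-y) = 2 * \<i> * of_real y" for a
    by (simp add: complex_eq_iff)
  then have e2: "1 / (2 * \<i> * of_real y) * (1 / Complex a (-y) - 1 / Complex a y) = 1 / of_real (a\<^sup>2 + y\<^sup>2)" for a
    unfolding inv diff_divide_distrib[symmetric] using y by simp
  have lim1: "1/2 * (of_real (pi / real m) * cot z + of_real (pi / real m) * cot w)
      = of_real (pi / real m * (sin \<theta> / (cosh X - cos \<theta>)))"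
    unfolding distrib_left[symmetric] add by (simp add: field_simps)
  have lim2: "1 / (2 * \<i> * of_real y) * (of_real (pi / real m) * cot w - of_real (pi / real m) * cot z)
      = of_real (pi / (real m * y) * (sinh X / (cosh X - cos \<theta>)))"
    unfolding right_diff_distrib[symmetric] diff using y by (simp add: field_simps)
  have odd: "complex_of_int n / of_real (of_int n ^ 2 + y\<^sup>2) = 1/2 * (P n + Q n)" for n
    unfolding P_def Q_def e1 by simp
  have "c * (p + q) + c * (p' + q') = c * ((p + p') + (q + q'))" for c p q p' q' :: complex
    by (simp add: algebra_simps)
  then show ?odd
    using sums_mult[OF sums_add[OF s], of "1/2"] unfolding lim1 odd by (simp only:)
  have even: "1 / complex_of_real (of_int n ^ 2 + y\<^sup>2) = 1 / (2 * \<i> * of_real y) * (Q n - P n)" for n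
    unfolding P_def Q_def e2 by simp
  have "c * (q - p) + c * (q' - p') = c * ((q + q') - (p + p'))" for c p q p' q' :: complex
    by (simp add: algebra_simps)
  then show ?even
    using sums_mult[OF sums_diff[OF s(2) s(1)], of "1 / (2 * \<i> * of_real y)"]
    unfolding lim2 even by (simp only:)
qed

section \<open>Continuation of periodic Dirichlet series\<close>

text \<open>The difference is zero off a sparse set or nonzero off a sparse set, and
  \<open>U\<close> excludes the second. Agreement at every single point is then due to niceness:
  equality near \<open>s\<close> gives both functions the same poles, where both take the value 0,
  and elsewhere the same limits, which are their values.\<close>

lemma nicely_meromorphic_eq_extend:
  assumes f: "f nicely_meromorphic_on A" and g: "g nicely_meromorphic_on A"
    and A: "open A" "connected A" and U: "open U" "U \<subseteq> A" "U \<noteq> {}"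
    and eq: "\<And>z. z \<in> U \<Longrightarrow> f z = g z" and s: "s \<in> A"
  shows "f s = g s"
proof -
  have "(\<lambda>z. f z - g z) meromorphic_on A"
    using f g by (auto simp: nicely_meromorphic_on_def intro!: meromorphic_intros)
  then consider "\<forall>\<^sub>\<approx>x\<in>A. f x - g x = 0" | "\<forall>\<^sub>\<approx>x\<in>A. f x - g x \<noteq> 0"
    using meromorphic_imp_constant_or_avoid[of "\<lambda>z. f z - g z" A 0] A by blast
  then have "\<forall>\<^sub>\<approx>x\<in>A. f x - g x = 0"
  proof cases
    case 2
    obtain u where u: "u \<in> U" using U by blast
    have "eventually (\<lambda>z. z \<in> U) (at u)"
      using U u by (metis eventually_at_topological)
    moreover have "eventually (\<lambda>x. f x - g x \<noteq> 0) (at u)"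
      using 2 u U A by (auto simp: eventually_cosparse_open_eq)
    ultimately have "eventually (\<lambda>x. False) (at u)"
      by eventually_elim (use eq in auto)
    then show ?thesis by simp
  qed
  then have ev: "eventually (\<lambda>x. f x = g x) (at s)"
    using s A by (auto simp: eventually_cosparse_open_eq)
  have fs: "is_pole f s \<and> f s = 0 \<or> f \<midarrow>s\<rightarrow> f s" and gs: "is_pole g s \<and> g s = 0 \<or> g \<midarrow>s\<rightarrow> g s"
    using f g s by (auto simp: nicely_meromorphic_on_def)
  have pole: "is_pole f s \<longleftrightarrow> is_pole g s"
    by (rule is_pole_cong[OF ev refl])
  show ?thesis
  proof (cases "is_pole f s")
    case True
    then have "\<not> (f \<midarrow>s\<rightarrow> f s)" "\<not> (g \<midarrow>s\<rightarrow> g s)"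
      using pole not_tendsto_and_filterlim_at_infinity[of "at s"] by (auto simp: is_pole_def)
    then show ?thesis using fs gs by simp
  next
    case False
    then have "f \<midarrow>s\<rightarrow> f s" "g \<midarrow>s\<rightarrow> g s"
      using fs gs pole by auto
    moreover have "f \<midarrow>s\<rightarrow> g s"
      using \<open>g \<midarrow>s\<rightarrow> g s\<close> tendsto_cong[OF ev] by simp
    ultimately show ?thesis
      using LIM_unique by blast
  qed
qed

lemma connected_halfplane_Re_gt: "connected {w. c < Re w}"
  by (intro convex_connected convex_halfspace_Re_gt)

text \<open>Makes the definite description usable: continuations to two different half-planes are
  compared on the smaller one, which is connected, starting from the part where \<open>Re w\<close>
  also exceeds 1.\<close>

lemma dirichlet_continuation_eqI:
  assumes f: "f nicely_meromorphic_on {w. c < Re w}" and c: "c < Re s"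
    and eq: "\<And>w. 1 < Re w \<Longrightarrow> f w = (\<Sum>n. dirichlet_term w g n)"
  shows "dirichlet_continuation s g = f s"
  unfolding dirichlet_continuation_def
proof (rule the_equality)
  show "\<exists>c fa. c < Re s \<and> fa nicely_meromorphic_on {w. c < Re w} \<and>
      (\<forall>w. 1 < Re w \<longrightarrow> fa w = (\<Sum>n. dirichlet_term w g n)) \<and> f s = fa s"
    using assms by blast
  fix v
  assume "\<exists>c f. c < Re s \<and> f nicely_meromorphic_on {w. c < Re w} \<and>
      (\<forall>w. 1 < Re w \<longrightarrow> f w = (\<Sum>n. dirichlet_term w g n)) \<and> v = f s"
  then obtain c' f' where c': "c' < Re s" and f': "f' nicely_meromorphic_on {w. c' < Re w}"
    and eq': "\<And>w. 1 < Re w \<Longrightarrow> f' w = (\<Sum>n. dirichlet_term w g n)" and v: "v = f' s"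
    by blast
  have "f' s = f s"
  proof (rule nicely_meromorphic_eq_extend[where f = f' and g = f and s = s and A = "{w. max c c' < Re w}" and U = "{w. max 1 (max c c') < Re w}"])
    show "f' nicely_meromorphic_on {w. max c c' < Re w}" "f nicely_meromorphic_on {w. max c c' < Re w}"
      using f f' by (auto elim!: nicely_meromorphic_on_subset)
    show "{w. max 1 (max c c') < Re w} \<noteq> {}"
      by (auto intro!: exI[of _ "of_real (max 1 (max c c') + 1)"])
    show "\<And>z. z \<in> {w. max 1 (max c c') < Re w} \<Longrightarrow> f' z = f z"
      using eq eq' by auto
  qed (use c c' in \<open>auto simp: open_halfspace_Re_gt connected_halfplane_Re_gt simp del: max_less_iff_conj\<close>)
  with v show "v = f s" by simp
qed

lemma powr_Taylor_bound:
  fixes c :: complex and u h :: real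
  assumes u: "u > 0" and h: "h \<ge> 0" and c: "Re c \<le> real n + 1"
  shows "cmod (of_real (u + h) powr c
      - (\<Sum>i\<le>n. (\<Prod>j<i. c - of_nat j) * of_real u powr (c - of_nat i) * of_real h ^ i / fact i))
    \<le> cmod (\<Prod>j<Suc n. c - of_nat j) * u powr (Re c - real n - 1) * h ^ Suc n / fact n"
proof -
  define f where "f i x = (\<Prod>j<i. c - of_nat j) * x powr (c - of_nat i)" for i and x :: complex
  define S where "S = closed_segment (complex_of_real u) (of_real (u + h))"
  have S: "\<exists>t. x = of_real t \<and> u \<le> t" if "x \<in> S" for x
    using that h unfolding S_def closed_segment_of_real by (auto simp: closed_segment_eq_real_ivl)
  have "cmod (f 0 (of_real (u + h)) - (\<Sum>i\<le>n. f i (of_real u) * (of_real (u + h) - of_real u) ^ i / fact i))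
    \<le> (cmod (\<Prod>j<Suc n. c - of_nat j) * u powr (Re c - real n - 1))
        * cmod (of_real (u + h) - of_real u) ^ Suc n / fact n"
  proof (rule complex_Taylor)
    show "convex S" unfolding S_def by simp
    show "of_real u \<in> S" "of_real (u + h) \<in> S" unfolding S_def by simp_all
    fix x assume "x \<in> S"
    then obtain t where t: "x = of_real t" "u \<le> t" using S by blast
    then have x: "x \<notin> \<real>\<^sub>\<le>\<^sub>0" using u by (auto simp: complex_nonpos_Reals_iff)
    show "(f i has_field_derivative f (Suc i) x) (at x within S)" for i
      unfolding f_def using x by (auto intro!: derivative_eq_intros simp: algebra_simps)
    have "cmod (x powr (c - of_nat (Suc n))) = t powr (Re c - real n - 1)"
      using t u by (subst norm_powr_real_powr) (auto simp: algebra_simps)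
    \<comment> \<open>The hypothesis on \<open>Re c\<close> makes this exponent nonpositive, so the
      highest derivative is largest at the left end of the segment.\<close>
    also have "\<dots> \<le> u powr (Re c - real n - 1)"
      using t u c by (intro powr_mono2') auto
    finally show "cmod (f (Suc n) x) \<le> cmod (\<Prod>j<Suc n. c - of_nat j) * u powr (Re c - real n - 1)"
      unfolding f_def norm_mult by (intro mult_left_mono) auto
  qed
  then show ?thesis
    using h by (simp add: f_def)
qed

text \<open>
  The error of the trapezoidal rule for \<open>x powr (- s)\<close> on \<open>[u, u + h]\<close>, multiplied by \<open>s - 1\<close> to make it entire in \<open>s\<close>.
\<close>

definition trapezoid_defect :: "real \<Rightarrow> real \<Rightarrow> complex \<Rightarrow> complex" where
  "trapezoid_defect h u s = of_real h * (s - 1) / 2 * (of_real u powr (- s) + of_real (u + h) powr (- s))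
     + of_real (u + h) powr (1 - s) - of_real u powr (1 - s)"

text \<open>The linear Taylor polynomial of \<open>x powr (- s)\<close> and the quadratic one of
  \<open>x powr (1 - s)\<close> at \<open>u\<close> cancel in the defect; the two remainders left
  contribute terms of order \<open>h ^ 3\<close>. The exponent \<open>- Re s - 2\<close> of
  \<open>u\<close> is summable along a progression for \<open>Re s > - 1\<close>, a region that
  contains the needed point 0.\<close>

lemma trapezoid_defect_bound:
  assumes u: "u > 0" and h: "h \<ge> 0" and s: "Re s > - 2"
  shows "cmod (trapezoid_defect h u s) \<le> cmod (s - 1) * cmod s * cmod (s + 1) * h ^ 3 * u powr (- Re s - 2)"
proof -
  define p where "p c = complex_of_real u powr c" for c
  define R1 R2 where "R1 = of_real (u + h) powr (- s) - (p (- s) - s * p (- s - 1) * h)"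
    and "R2 = of_real (u + h) powr (1 - s)
      - (p (1 - s) + (1 - s) * p (- s) * h + (1 - s) * (- s) * p (- s - 1) * h\<^sup>2 / 2)"
  define B where "B = cmod s * cmod (s + 1) * u powr (- Re s - 2)"
  have e: "Re (- s) - real 1 - 1 = - Re s - 2" "Re (1 - s) - real 2 - 1 = - Re s - 2"
    by simp_all
  have "(\<Prod>j<Suc 1. - s - of_nat j) = s * (s + 1)"
    by (simp add: lessThan_Suc algebra_simps)
  moreover have "(\<Sum>i\<le>1. (\<Prod>j<i. - s - of_nat j) * of_real u powr (- s - of_nat i) * of_real h ^ i / fact i)
      = p (- s) - s * p (- s - 1) * h"
    by (simp add: p_def)
  ultimately have "cmod R1 \<le> B * h\<^sup>2"
    using powr_Taylor_bound[of u h "- s" 1, unfolded e] u h s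
    unfolding R1_def B_def by (simp add: norm_mult power2_eq_square del: prod.lessThan_Suc sum.atMost_Suc)
  moreover have "(\<Prod>j<Suc 2. 1 - s - of_nat j) = (1 - s) * (s * (s + 1))"
    by (simp add: numeral_2_eq_2 algebra_simps)
  moreover have "(\<Sum>i\<le>2. (\<Prod>j<i. 1 - s - of_nat j) * of_real u powr (1 - s - of_nat i) * of_real h ^ i / fact i)
      = p (1 - s) + (1 - s) * p (- s) * h + (1 - s) * (- s) * p (- s - 1) * h\<^sup>2 / 2"
    by (simp add: p_def numeral_2_eq_2 minus_diff_commute[of 1 s])
  ultimately have "cmod R2 \<le> cmod (s - 1) * B * h ^ 3 / 2"
    using powr_Taylor_bound[of u h "1 - s" 2, unfolded e] u h s
    unfolding R2_def B_def
    by (simp add: norm_mult numeral_3_eq_3 norm_minus_commute mult.assoc del: prod.lessThan_Suc sum.atMost_Suc)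
  have "trapezoid_defect h u s = of_real h * (s - 1) / 2 * R1 + R2"
    unfolding trapezoid_defect_def R1_def R2_def p_def[symmetric]
    by (simp add: field_simps power2_eq_square)
  then have "cmod (trapezoid_defect h u s) \<le> h * cmod (s - 1) / 2 * cmod R1 + cmod R2"
    using h norm_triangle_ineq[of "of_real h * (s - 1) / 2 * R1" R2] by (simp add: norm_mult norm_divide)
  moreover have "h * cmod (s - 1) / 2 * cmod R1 \<le> h * cmod (s - 1) / 2 * (B * h\<^sup>2)"
    using h \<open>cmod R1 \<le> B * h\<^sup>2\<close> by (intro mult_left_mono) auto
  moreover have "h * cmod (s - 1) / 2 * (B * h\<^sup>2) + cmod (s - 1) * B * h ^ 3 / 2
      = cmod (s - 1) * cmod s * cmod (s + 1) * h ^ 3 * u powr (- Re s - 2)"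
    by (simp add: B_def power2_eq_square power3_eq_cube)
  ultimately show ?thesis
    using \<open>cmod R2 \<le> cmod (s - 1) * B * h ^ 3 / 2\<close> by linarith
qed

text \<open>At \<open>s = 0\<close> the integrand is constant, and the trapezoidal rule is
  exact.\<close>

lemma trapezoid_defect_0:
  assumes "u > 0" "h \<ge> 0"
  shows "trapezoid_defect h u 0 = 0"
proof -
  have "complex_of_real (u + h) \<noteq> 0"
    using assms by (simp only: of_real_eq_0_iff)
  then show ?thesis
    using assms by (simp add: trapezoid_defect_def)
qed

definition progression_defect :: "nat \<Rightarrow> nat \<Rightarrow> complex \<Rightarrow> complex" where
  "progression_defect m r s = (\<Sum>l. trapezoid_defect (real m) (real (l * m + r)) s)"

lemma holomorphic_progression_defect:
  assumes m: "m > 0" and r: "r > 0"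
  shows "progression_defect m r holomorphic_on {s. Re s > - 1}"
proof (rule holomorphic_uniform_sequence
    [where f = "\<lambda>n s. \<Sum>l<n. trapezoid_defect (real m) (real (l * m + r)) s"])
  show "open {s. - 1 < Re s}" by (rule open_halfspace_Re_gt)
  show "(\<lambda>s. \<Sum>l<n. trapezoid_defect (real m) (real (l * m + r)) s) holomorphic_on {s. - 1 < Re s}" for n
    unfolding trapezoid_defect_def using r
    by (intro holomorphic_intros) (auto simp: complex_nonpos_Reals_iff)
  fix s assume s: "s \<in> {s. - 1 < Re s}"
  \<comment> \<open>Half the distance from \<open>s\<close> to the line \<open>Re w = - 1\<close>:
    on the whole disc \<open>Re w\<close> is at least \<sigma>, and
    \<open>- \<sigma> - 2 < - 1\<close> keeps the majorant summable.\<close>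
  define d where "d = (Re s + 1) / 2"
  define \<sigma> where "\<sigma> = Re s - d"
  have d: "d > 0" and \<sigma>: "\<sigma> > - 1"
    using s by (auto simp: d_def \<sigma>_def field_simps)
  have re: "Re w \<ge> \<sigma>" if "w \<in> cball s d" for w
  proof -
    have "\<bar>Re (s - w)\<bar> \<le> d"
      using that abs_Re_le_cmod[of "s - w"] by (simp add: dist_norm)
    then show ?thesis by (simp add: \<sigma>_def)
  qed
  define K where "K = cmod s + d + 1"
  have K: "cmod w \<le> K" "cmod (w - 1) \<le> K" "cmod (w + 1) \<le> K" if "w \<in> cball s d" for w
  proof -
    have "cmod w \<le> cmod s + d"
      using that norm_triangle_ineq2[of w s] by (simp add: dist_norm norm_minus_commute)
    then show "cmod w \<le> K" "cmod (w - 1) \<le> K" "cmod (w + 1) \<le> K"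
      using norm_triangle_ineq4[of w 1] norm_triangle_ineq[of w 1] by (auto simp: K_def)
  qed
  have "uniform_limit (cball s d) (\<lambda>n s. \<Sum>l<n. trapezoid_defect (real m) (real (l * m + r)) s)
      (\<lambda>s. \<Sum>l. trapezoid_defect (real m) (real (l * m + r)) s) sequentially"
  proof (rule Weierstrass_m_test)
    fix l w assume w: "w \<in> cball s d"
    have pos: "real (Suc l) \<le> real (l * m + r)"
    proof -
      have "l * 1 \<le> l * m" using m by (intro mult_le_mono2) simp
      then show ?thesis using r by linarith
    qed
    have "real (l * m + r) powr (- Re w - 2) \<le> real (Suc l) powr (- Re w - 2)"
      using pos re[OF w] \<sigma> by (intro powr_mono2') auto
    also have "\<dots> \<le> real (Suc l) powr (- \<sigma> - 2)"
      using re[OF w] by (intro powr_mono) auto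
    finally have p: "real (l * m + r) powr (- Re w - 2) \<le> real (Suc l) powr (- \<sigma> - 2)" .
    have "cmod (trapezoid_defect (real m) (real (l * m + r)) w)
        \<le> cmod (w - 1) * cmod w * cmod (w + 1) * real m ^ 3 * real (l * m + r) powr (- Re w - 2)"
      using pos re[OF w] \<sigma> by (intro trapezoid_defect_bound) linarith+
    also have "\<dots> \<le> K * K * K * real m ^ 3 * real (Suc l) powr (- \<sigma> - 2)"
      using K[OF w] p order.trans[OF norm_ge_zero K(1)[OF w]] by (intro mult_mono mult_nonneg_nonneg) simp_all
    finally show "cmod (trapezoid_defect (real m) (real (l * m + r)) w)
        \<le> K * K * K * real m ^ 3 * real (Suc l) powr (- \<sigma> - 2)" .
  next
    have "summable (\<lambda>l. real (Suc l) powr (- \<sigma> - 2))"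
      using \<sigma> by (subst summable_Suc_iff[of "\<lambda>l. real l powr (- \<sigma> - 2)"]) (simp add: summable_real_powr_iff)
    then show "summable (\<lambda>l. K * K * K * real m ^ 3 * real (Suc l) powr (- \<sigma> - 2))"
      by (rule summable_mult)
  qed
  moreover have "cball s d \<subseteq> {s. - 1 < Re s}"
    using re \<sigma> by fastforce
  ultimately show "\<exists>d>0. cball s d \<subseteq> {s. - 1 < Re s} \<and>
      uniform_limit (cball s d) (\<lambda>n s. \<Sum>l<n. trapezoid_defect (real m) (real (l * m + r)) s)
        (progression_defect m r) sequentially"
    using d by (auto simp: progression_defect_def[abs_def])
qed

text \<open>
  The right-hand side solves the telescoped sum of the trapezoidal defects for the Dirichlet series
  of the arithmetic progression \<open>r, r + m, r + 2 m, \<dots>\<close>.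
\<close>

definition progression_L :: "nat \<Rightarrow> nat \<Rightarrow> complex \<Rightarrow> complex" where
  "progression_L m r s =
     (progression_defect m r s + of_nat r powr (1 - s)) / (of_nat m * (s - 1)) + of_nat r powr (- s) / 2"

lemma progression_L_sums:
  assumes m: "m > 0" and r: "r > 0" and s: "Re s > 1"
  shows "(\<lambda>l. of_nat (l * m + r) powr (- s)) sums progression_L m r s"
proof -
  define a b where "a l = (of_nat (l * m + r) :: complex) powr (- s)"
    and "b l = (of_nat (l * m + r) :: complex) powr (1 - s)" for l
  have pos: "real (Suc l) \<le> real (l * m + r)" for l
  proof -
    have "l * 1 \<le> l * m" using m by (intro mult_le_mono2) simp
    then show ?thesis using r by linarith
  qed
  have na: "cmod (a l) = real (l * m + r) powr (- Re s)"
   and nb: "cmod (b l) = real (l * m + r) powr (1 - Re s)" for l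
    using pos[of l] norm_powr_real_powr[of "of_nat (l * m + r)"] by (simp_all add: a_def b_def)
  have "summable (\<lambda>l. real (Suc l) powr (- Re s))"
    using s by (subst summable_Suc_iff[of "\<lambda>l. real l powr (- Re s)"]) (simp add: summable_real_powr_iff)
  moreover have "cmod (a l) \<le> real (Suc l) powr (- Re s)" for l
    unfolding na using pos[of l] s by (intro powr_mono2') auto
  ultimately have a: "a sums suminf a"
    by (intro summable_sums summable_comparison_test'[of _ 0 a]) auto
  have "(\<lambda>l. real (Suc l) powr (1 - Re s)) \<longlonglongrightarrow> 0"
    using s by (intro tendsto_neg_powr filterlim_compose[OF filterlim_real_sequentially filterlim_Suc]) auto
  moreover have "cmod (b l) \<le> real (Suc l) powr (1 - Re s)" for l
    unfolding nb using pos[of l] s by (intro powr_mono2') auto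
  ultimately have b: "b \<longlonglongrightarrow> 0"
    by (intro Lim_null_comparison[of b]) auto
  have a': "(\<lambda>l. a (Suc l)) sums (suminf a - a 0)"
    using a by (simp add: sums_Suc_iff)
  \<comment> \<open>The end point values of all steps add up to twice the series minus its first
    term; the integrals telescope.\<close>
  have "(\<lambda>l. of_nat m * (s - 1) / 2 * (a l + a (Suc l)) + (b (Suc l) - b l))
      sums (of_nat m * (s - 1) / 2 * (suminf a + (suminf a - a 0)) + (0 - b 0))"
    by (intro sums_add sums_mult a a' telescope_sums b)
  moreover have "trapezoid_defect (real m) (real (l * m + r)) s
      = of_nat m * (s - 1) / 2 * (a l + a (Suc l)) + (b (Suc l) - b l)" for l
  proof -
    have "of_real (real (l * m + r)) = (of_nat (l * m + r) :: complex)"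
      "of_real (real (l * m + r) + real m) = (of_nat (Suc l * m + r) :: complex)"
      by (simp_all add: algebra_simps)
    then show ?thesis
      unfolding trapezoid_defect_def a_def b_def by (simp only: of_real_of_nat_eq) (simp only: add_diff_eq)
  qed
  ultimately have "progression_defect m r s
      = of_nat m * (s - 1) / 2 * (suminf a + (suminf a - a 0)) + (0 - b 0)"
    unfolding progression_defect_def by (simp add: sums_iff)
  moreover have "s \<noteq> 1" using s by auto
  ultimately have "progression_L m r s = suminf a"
    unfolding progression_L_def using m by (simp add: a_def b_def field_simps)
  then show ?thesis
    using a by (simp add: a_def[abs_def])
qed

text \<open>All defects vanish at 0, so only the terms at the first point remain. This is the value
  \<open>1 / 2 - x\<close> of the Hurwitz zeta function at 0, with \<open>x = r / m\<close>.\<close>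

lemma progression_L_0:
  assumes "m > 0" "r > 0"
  shows "progression_L m r 0 = 1 / 2 - of_nat r / of_nat m"
proof -
  have "trapezoid_defect (real m) (real (l * m + r)) 0 = 0" for l
    using assms by (intro trapezoid_defect_0) (simp_all only: of_nat_0_less_iff of_nat_0_le_iff)
  then show ?thesis
    using assms by (simp add: progression_L_def progression_defect_def field_simps)
qed

section \<open>Periodic Dirichlet series and their value at 0\<close>

lemma sums_by_residues:
  fixes h :: "nat \<Rightarrow> 'a::{topological_comm_monoid_add,t2_space}"
  assumes m: "m > 0" and h: "h sums S" and sub: "\<And>r. r < m \<Longrightarrow> (\<lambda>l. h (l * m + r)) sums T r"
  shows "S = (\<Sum>r<m. T r)"
proof -
  have "(\<Sum>n<K*m. h n) = (\<Sum>r<m. \<Sum>l<K. h (l * m + r))" for K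
    unfolding sum_lessThan_mult by (rule sum.swap)
  moreover have "(\<lambda>K. \<Sum>r<m. \<Sum>l<K. h (l * m + r)) \<longlonglongrightarrow> (\<Sum>r<m. T r)"
    using sub by (intro tendsto_sum) (auto simp: sums_def)
  moreover have "(\<lambda>K. \<Sum>n<K*m. h n) \<longlonglongrightarrow> S"
    using LIMSEQ_subseq_LIMSEQ[OF h[unfolded sums_def], of "\<lambda>K. K * m"] m
    by (simp add: o_def strict_mono_def)
  ultimately show ?thesis
    using LIMSEQ_unique by auto
qed

lemma periodic_bounded:
  fixes g :: "int \<Rightarrow> complex"
  assumes m: "m > 0" and per: "\<And>n. g (n + int m) = g n"
  obtains B where "\<And>n. cmod (g n) \<le> B" "B \<ge> 0"
proof -
  have "cmod (g n) \<le> (\<Sum>r<m. cmod (g (int r)))" for n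
  proof -
    have "g n = g (n mod int m)"
      using periodic_add_mult[of g m "n mod int m" "n div int m", OF per] by simp
    moreover have "cmod (g (int (nat (n mod int m)))) \<le> (\<Sum>r<m. cmod (g (int r)))"
      using m by (intro member_le_sum[of _ "{..<m}" "\<lambda>r. cmod (g (int r))"]) (auto simp: nat_less_iff)
    ultimately show ?thesis using m by simp
  qed
  then show ?thesis
    using that[of "\<Sum>r<m. cmod (g (int r))"] by (simp add: sum_nonneg)
qed

lemma summable_dirichlet_term:
  assumes m: "m > 0" and per: "\<And>n. g (n + int m) = g n" and s: "Re s > 1"
  shows "summable (dirichlet_term s g)"
proof -
  obtain B where B: "\<And>n. cmod (g n) \<le> B" "B \<ge> 0"
    using periodic_bounded[of m g, OF m per] by blast
  have "summable (\<lambda>l. real (Suc l) powr (- Re s))"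
    using s by (subst summable_Suc_iff[of "\<lambda>l. real l powr (- Re s)"]) (simp add: summable_real_powr_iff)
  then have "summable (\<lambda>l. B * real (Suc l) powr (- Re s))"
    by (rule summable_mult)
  moreover have "cmod (dirichlet_term s g n) \<le> B * real (Suc n) powr (- Re s)" for n
    using norm_powr_real_powr[of "of_nat (Suc n)" "- s"] B
    by (auto simp: dirichlet_term_def norm_mult intro!: mult_mono simp del: of_nat_Suc)
  ultimately show ?thesis
    by (rule summable_comparison_test'[where N = 0])
qed

lemma suminf_dirichlet_term:
  assumes m: "m > 0" and per: "\<And>n. g (n + int m) = g n" and s: "Re s > 1"
  shows "(\<Sum>n. dirichlet_term s g n) = (\<Sum>r<m. g (int (Suc r)) * progression_L m (Suc r) s)"
proof (rule sums_by_residues[OF m])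
  show "dirichlet_term s g sums (\<Sum>n. dirichlet_term s g n)"
    using summable_dirichlet_term[of m g s, OF assms] by (rule summable_sums)
  fix r
  have "dirichlet_term s g (l * m + r) = g (int (Suc r)) * of_nat (l * m + Suc r) powr (- s)" for l
    using periodic_add_mult[of g m "int (Suc r)" "int l", OF per]
    by (simp add: dirichlet_term_def algebra_simps)
  then show "(\<lambda>l. dirichlet_term s g (l * m + r)) sums (g (int (Suc r)) * progression_L m (Suc r) s)"
    using sums_mult[OF progression_L_sums[OF m _ s, of "Suc r"]] by simp
qed

lemma dirichlet_continuation_0:
  assumes m: "m > 0" and per: "\<And>n. g (n + int m) = g n"
  shows "dirichlet_continuation 0 g = (\<Sum>r<m. g (int (Suc r)) * (1 / 2 - of_nat (Suc r) / of_nat m))"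
proof -
  define f where "f s = (\<Sum>r<m. g (int (Suc r)) * progression_L m (Suc r) s)" for s
  have hol: "f holomorphic_on {s. Re s > - 1} - {1}"
    unfolding f_def progression_L_def using m
    by (intro holomorphic_intros holomorphic_on_subset[OF holomorphic_progression_defect])
       (auto simp: complex_nonpos_Reals_iff)
  then have an: "f analytic_on {s. Re s > - 1} - {1}"
    by (subst analytic_on_open) (auto intro!: open_Diff open_halfspace_Re_gt)
  have "progression_defect m (Suc r) meromorphic_on {s. Re s > - 1}" for r
    using holomorphic_progression_defect[OF m, of "Suc r"]
    by (intro analytic_on_imp_meromorphic_on) (simp add: analytic_on_open open_halfspace_Re_gt)
  moreover have "(\<lambda>s. of_nat (Suc r) powr (1 - s)) meromorphic_on {s. Re s > - 1}"
      "(\<lambda>s. of_nat (Suc r) powr (- s)) meromorphic_on {s. Re s > - 1}" for r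
    by (intro analytic_on_imp_meromorphic_on analytic_intros; simp add: complex_nonpos_Reals_iff)+
  ultimately have "f meromorphic_on {s. Re s > - 1}"
    unfolding f_def progression_L_def by (intro meromorphic_intros)
  \<comment> \<open>At \<open>s = 1\<close> division by zero assigns \<open>f\<close> a value
    unrelated to its behaviour nearby, so \<open>f\<close> itself need not be nicely meromorphic.
    Away from 1, which covers 0 and the half-plane of convergence, nothing changes.\<close>
  then have "remove_sings f nicely_meromorphic_on {w. - 1 < Re w}"
    by (rule remove_sings_nicely_meromorphic)
  moreover have rs: "remove_sings f s = f s" if "Re s > - 1" "s \<noteq> 1" for s
    by (rule remove_sings_at_analytic, rule analytic_on_subset[OF an]) (use that in auto)
  ultimately have "dirichlet_continuation 0 g = remove_sings f 0"
    using suminf_dirichlet_term[of m g, OF m per]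
    unfolding f_def[symmetric] by (intro dirichlet_continuation_eqI[where c = "-1"]) (auto intro!: rs)
  also have "\<dots> = (\<Sum>r<m. g (int (Suc r)) * (1 / 2 - of_nat (Suc r) / of_nat m))"
    using rs[of 0] m progression_L_0 by (simp add: f_def)
  finally show ?thesis .
qed

text \<open>The weight \<open>1 / 2 - r / m\<close> changes sign under
  \<open>r \<mapsto> m - r\<close> while an even \<open>g\<close> does not, so everything cancels
  except \<open>r = m\<close>, whose weight is \<open>- 1 / 2\<close>. Since
  \<open>dirichlet_L\<close> prefers the series where it converges, that branch has to be settled as
  well: convergence at 0 forces the periodic \<open>g\<close> to vanish.\<close>

lemma dirichlet_L_0:
  assumes m: "m > 0" and per: "\<And>n. g (n + int m) = g n" and even: "\<And>n. g (- n) = g n"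
  shows "dirichlet_L 0 g = - g 0 / 2"
proof (cases "summable (dirichlet_term 0 g)")
  case True
  then have lim: "(\<lambda>n. g (int (Suc n))) \<longlonglongrightarrow> 0"
    using summable_LIMSEQ_zero[OF True] by (simp add: dirichlet_term_def[abs_def] del: of_nat_Suc)
  have "g j = 0" for j
  proof -
    \<comment> \<open>The successor of this index is \<open>j mod m + (k + 1) * m\<close>, congruent
      to \<open>j\<close>; the extra period keeps the subtraction of 1 from truncating when the
      residue is 0.\<close>
    have "strict_mono (\<lambda>k. nat (j mod int m) + k * m + m - 1)"
      using m by (intro strict_monoI diff_less_mono add_strict_right_mono add_strict_left_mono mult_strict_right_mono) simp_all
    from LIMSEQ_subseq_LIMSEQ[OF lim this]
    have "(\<lambda>k. g (int (Suc (nat (j mod int m) + k * m + m - 1)))) \<longlonglongrightarrow> 0"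
      by (simp add: o_def)
    moreover have "g (int (Suc (nat (j mod int m) + k * m + m - 1))) = g j" for k
    proof -
      have "int (Suc (nat (j mod int m) + k * m + m - 1)) = j + (int k + 1 - j div int m) * int m"
      proof -
        have "int (nat (j mod int m)) = j - int m * (j div int m)"
          using m by (simp add: minus_mult_div_eq_mod)
        then show ?thesis
          using m by (simp add: algebra_simps of_nat_diff del: nat_mod_distrib int_nat_eq)
      qed
      then show ?thesis
        using periodic_add_mult[of g m, OF per] by metis
    qed
    ultimately show "g j = 0" by (simp add: LIMSEQ_const_iff)
  qed
  then show ?thesis
    by (simp add: dirichlet_L_def True dirichlet_term_def[abs_def])
next
  case False
  obtain k where k: "m = Suc k" using m by (cases m) auto
  define F where "F j = g (int j) * (1 / 2 - of_nat j / of_nat m)" for j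
  have "(\<Sum>r<k. F (Suc r)) = (\<Sum>r<k. F (Suc (k - Suc r)))"
    by (rule sum.nat_diff_reindex[symmetric])
  also have "\<dots> = (\<Sum>r<k. - F (Suc r))"
  proof (rule sum.cong[OF refl])
    fix r assume "r \<in> {..<k}"
    then have i: "int (Suc (k - Suc r)) = - int (Suc r) + int m"
      and c: "(of_nat (Suc (k - Suc r)) :: complex) = of_nat m - of_nat (Suc r)"
      by (auto simp: k of_nat_diff)
    have "g (int (Suc (k - Suc r))) = g (int (Suc r))"
      unfolding i per even ..
    then show "F (Suc (k - Suc r)) = - F (Suc r)"
      unfolding F_def c using m by (simp add: field_simps del: of_nat_Suc)
  qed
  finally have "(\<Sum>r<k. F (Suc r)) = 0"
    by (simp add: sum_negf)
  moreover have "F m = - g 0 / 2"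
    using m per[of 0] by (simp add: F_def)
  ultimately have "(\<Sum>r<m. F (Suc r)) = - g 0 / 2"
    by (simp add: k)
  then show ?thesis
    using False dirichlet_continuation_0[of m g, OF m per] by (simp add: dirichlet_L_def F_def)
qed

section \<open>Conditionally convergent sums over a period\<close>

lemma summation_by_parts:
  fixes a d :: "nat \<Rightarrow> 'a::comm_ring_1"
  shows "(\<Sum>n<N. a n * d n) = (\<Sum>n<N. a n) * d N + (\<Sum>n<N. (\<Sum>i<Suc n. a i) * (d n - d (Suc n)))"
  by (induction N) (simp_all add: algebra_simps)

text \<open>After summation by parts the differences of \<open>d\<close> are nonnegative and
  telescope. The bound does not depend on \<open>N\<close>, as the later exchange of summations
  requires.\<close>

lemma Dirichlet_test:
  fixes a :: "nat \<Rightarrow> complex" and d :: "nat \<Rightarrow> real"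
  assumes d: "decseq d" "d \<longlonglongrightarrow> 0" and B: "\<And>N. cmod (\<Sum>n<N. a n) \<le> B"
  shows Dirichlet_test_bound: "cmod (\<Sum>n<N. a n * of_real (d n)) \<le> B * d 0"
    and Dirichlet_test_summable: "summable (\<lambda>n. a n * of_real (d n))"
proof -
  define A where "A N = (\<Sum>n<N. a n)" for N
  have A: "cmod (A N) \<le> B" for N using B by (simp add: A_def)
  have d0: "d n \<ge> 0" for n using d by (rule decseq_ge)
  have dd: "d n - d (Suc n) \<ge> 0" for n using d(1) by (simp add: decseq_Suc_iff)
  have parts: "(\<Sum>n<N. a n * of_real (d n)) = A N * of_real (d N) + (\<Sum>n<N. A (Suc n) * of_real (d n - d (Suc n)))" for N
    unfolding A_def by (subst summation_by_parts) simp
  have le: "cmod (A (Suc n) * of_real (d n - d (Suc n))) \<le> B * (d n - d (Suc n))" for n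
    using dd[of n] A by (auto simp: norm_mult simp del: of_real_diff intro!: mult_mono order.trans[OF norm_ge_zero A])
  show "cmod (\<Sum>n<N. a n * of_real (d n)) \<le> B * d 0"
  proof -
    have "cmod (A N * of_real (d N)) \<le> B * d N"
      using d0[of N] A by (auto simp: norm_mult intro!: mult_right_mono)
    moreover have "cmod (\<Sum>n<N. A (Suc n) * of_real (d n - d (Suc n))) \<le> (\<Sum>n<N. B * (d n - d (Suc n)))"
      using le by (intro sum_norm_le)
    moreover have "(\<Sum>n<N. B * (d n - d (Suc n))) = B * (d 0 - d N)"
      unfolding sum_distrib_left[symmetric] sum_lessThan_telescope' ..
    ultimately have "cmod (\<Sum>n<N. a n * of_real (d n)) \<le> B * d N + B * (d 0 - d N)"
      unfolding parts
      using norm_triangle_ineq[of "A N * of_real (d N)" "\<Sum>n<N. A (Suc n) * of_real (d n - d (Suc n))"]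
      by linarith
    then show ?thesis by (simp add: algebra_simps)
  qed
  have "summable (\<lambda>n. B * (d n - d (Suc n)))"
    by (rule summable_mult[OF telescope_summable'[OF d(2)]])
  then have "summable (\<lambda>n. A (Suc n) * of_real (d n - d (Suc n)))"
    by (rule summable_comparison_test'[where N = 0]) (rule le)
  then have "(\<lambda>N. \<Sum>n<N. A (Suc n) * of_real (d n - d (Suc n))) \<longlonglongrightarrow> (\<Sum>n. A (Suc n) * of_real (d n - d (Suc n)))"
    by (rule summable_LIMSEQ)
  moreover have "(\<lambda>N. A N * of_real (d N)) \<longlonglongrightarrow> 0"
  proof (rule Lim_null_comparison)
    show "(\<lambda>N. B * d N) \<longlonglongrightarrow> 0"
      using tendsto_mult_left[OF d(2), of B] by simp
    show "\<forall>\<^sub>F N in sequentially. cmod (A N * of_real (d N)) \<le> B * d N"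
      using d0 A by (auto simp: norm_mult intro!: mult_right_mono always_eventually)
  qed
  ultimately have "(\<lambda>N. \<Sum>n<N. a n * of_real (d n)) \<longlonglongrightarrow> 0 + (\<Sum>n. A (Suc n) * of_real (d n - d (Suc n)))"
    unfolding parts by (intro tendsto_add)
  then show "summable (\<lambda>n. a n * of_real (d n))"
    by (auto simp: summable_def sums_def)
qed

text \<open>Tannery's theorem applied to the partial sums over \<open>n\<close>. The majorant bounds
  these sums and not the single terms, so the series over \<open>n\<close> may converge
  conditionally.\<close>

lemma suminf_swap_dominated:
  fixes f :: "nat \<Rightarrow> nat \<Rightarrow> complex"
  assumes row: "\<And>n. summable (f n)" and col: "\<And>k. (\<lambda>n. f n k) sums G k"
    and bound: "\<And>N k. cmod (\<Sum>n<N. f n k) \<le> h k" and h: "summable h"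
  shows "(\<lambda>n. \<Sum>k. f n k) sums (\<Sum>k. G k)"
proof -
  have "((\<lambda>N. \<Sum>k. \<Sum>n<N. f n k) \<longlonglongrightarrow> (\<Sum>k. G k))"
  proof -
    have "\<forall>\<^sub>F (k, N) in sequentially \<times>\<^sub>F sequentially. cmod (\<Sum>n<N. f n k) \<le> h k"
      using bound by (intro always_eventually) auto
    then show ?thesis
      using tannerys_theorem[of "\<lambda>k N. \<Sum>n<N. f n k" G sequentially h] col h by (auto simp: sums_def)
  qed
  moreover have "(\<Sum>k. \<Sum>n<N. f n k) = (\<Sum>n<N. \<Sum>k. f n k)" for N
    using row by (intro suminf_sum) auto
  ultimately show ?thesis by (simp add: sums_def)
qed

lemma sum_period_shift:
  fixes g :: "int \<Rightarrow> complex"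
  assumes per: "\<And>n. g (n + int m) = g n"
  shows "(\<Sum>r<m. g (int (Suc r))) = (\<Sum>r<m. g (int r))"
proof -
  have "(\<Sum>r<m. g (int r)) + g (int m) = g (int 0) + (\<Sum>r<m. g (int (Suc r)))"
    using sum.lessThan_Suc[of "\<lambda>r. g (int r)" m] sum.lessThan_Suc_shift[of "\<lambda>r. g (int r)" m] by metis
  then show ?thesis using per[of 0] by simp
qed

lemma odd_periodic_sum_eq_0:
  fixes g :: "int \<Rightarrow> complex"
  assumes per: "\<And>n. g (n + int m) = g n" and odd: "\<And>n. g (- n) = - g n"
  shows "(\<Sum>r<m. g (int r)) = 0"
proof -
  have "(\<Sum>r<m. g (int r)) = (\<Sum>r<m. g (int (m - Suc r)))"
    by (rule sum.nat_diff_reindex[symmetric])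
  also have "\<dots> = (\<Sum>r<m. - g (int (Suc r)))"
  proof (rule sum.cong[OF refl])
    fix r assume "r \<in> {..<m}"
    then have "int (m - Suc r) = - int (Suc r) + int m" by auto
    then show "g (int (m - Suc r)) = - g (int (Suc r))" by (simp only: per odd)
  qed
  also have "\<dots> = - (\<Sum>r<m. g (int r))"
    using sum_period_shift[of g m, OF per] by (simp add: sum_negf)
  finally show ?thesis by simp
qed

lemma periodic_partial_sums_bounded:
  fixes g :: "int \<Rightarrow> complex"
  assumes m: "m > 0" and per: "\<And>n. g (n + int m) = g n" and zero: "(\<Sum>r<m. g (int r)) = 0"
  obtains B where "\<And>N. cmod (\<Sum>n<N. g (int (Suc n))) \<le> B" "B \<ge> 0"
proof -
  define A where "A N = (\<Sum>n<N. g (int (Suc n)))" for N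
  \<comment> \<open>Every window of \<open>m\<close> consecutive values has sum 0, so the partial
    sums are themselves periodic and take finitely many values.\<close>
  have "(\<Sum>i<m. g (int (Suc (N + i)))) = 0" for N
  proof (induction N)
    case 0
    then show ?case using zero sum_period_shift[of g m, OF per] by simp
  next
    case (Suc N)
    define g' where "g' n = g (n + int (Suc N))" for n
    have "(\<Sum>r<m. g' (int (Suc r))) = (\<Sum>r<m. g' (int r))"
    proof (rule sum_period_shift)
      show "g' (n + int m) = g' n" for n
        using per[of "n + int (Suc N)"] by (simp add: g'_def algebra_simps)
    qed
    then show ?case using Suc by (simp add: g'_def algebra_simps)
  qed
  note window = this
  have per_A: "A (N + m) = A N" for N
  proof -
    have "(\<Sum>n<N + k. f n) = (\<Sum>n<N. f n) + (\<Sum>i<k. f (N + i))" for k and f :: "nat \<Rightarrow> complex"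
      by (induction k) (simp_all add: add.assoc)
    then show ?thesis using window[of N] by (simp add: A_def)
  qed
  have A_mod: "A N = A (N mod m)" for N
  proof (induction N rule: less_induct)
    case (less N)
    show ?case
    proof (cases "N < m")
      case False
      then have "A N = A (N - m)" using per_A[of "N - m"] by simp
      also have "\<dots> = A ((N - m) mod m)" using False m by (intro less) simp
      finally show ?thesis using False by (simp add: le_mod_geq)
    qed simp
  qed
  have "cmod (A N) \<le> (\<Sum>r<m. cmod (A r))" for N
    unfolding A_mod[of N] using m by (intro member_le_sum[of _ "{..<m}" "\<lambda>r. cmod (A r)"]) auto
  then show ?thesis
    using that[of "\<Sum>r<m. cmod (A r)"] by (simp add: A_def sum_nonneg)
qed

section \<open>Partial sums against the kernels, with bounds uniform in their length\<close>

lemma decseq_power_sum: "decseq (\<lambda>n. 1 / (real (Suc n) ^ e * ((real (Suc n))\<^sup>2 + y\<^sup>2)))"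
  by (intro decseq_SucI divide_left_mono mult_mono add_right_mono power_mono mult_pos_pos)
     (auto intro!: add_pos_nonneg)

lemma tendsto_power_sum: "(\<lambda>n. 1 / (real (Suc n) ^ e * ((real (Suc n))\<^sup>2 + y\<^sup>2))) \<longlonglongrightarrow> 0"
proof (rule Lim_null_comparison)
  show "(\<lambda>n. 1 / real (Suc n)) \<longlonglongrightarrow> 0"
    using LIMSEQ_inverse_real_of_nat by (simp add: inverse_eq_divide)
  show "\<forall>\<^sub>F n in sequentially. norm (1 / (real (Suc n) ^ e * ((real (Suc n))\<^sup>2 + y\<^sup>2))) \<le> 1 / real (Suc n)"
  proof (intro always_eventually allI)
    fix n
    have "1 * real (Suc n) \<le> real (Suc n) ^ e * ((real (Suc n))\<^sup>2 + y\<^sup>2)"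
    proof (rule mult_mono)
      show "1 \<le> real (Suc n) ^ e" by (rule one_le_power) simp
      show "real (Suc n) \<le> (real (Suc n))\<^sup>2 + y\<^sup>2"
        using self_le_power[of "real (Suc n)" 2] by (intro add_increasing2) auto
    qed auto
    then show "norm (1 / (real (Suc n) ^ e * ((real (Suc n))\<^sup>2 + y\<^sup>2))) \<le> 1 / real (Suc n)"
      by (auto simp: divide_simps simp del: of_nat_Suc)
  qed
qed

text \<open>The kernel \<open>n / (n^2 + y^2)\<close> increases until \<open>n\<close> is about the
  size of \<open>y\<close>, so the Dirichlet test does not apply to it directly. It is the
  difference of the decreasing sequences \<open>1 / n\<close> and
  \<open>y^2 / (n * (n^2 + y^2))\<close>. Both start at a value of at most 1, whence the constant
  \<open>2 * B\<close>, independent of \<open>y\<close>.\<close>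

lemma odd_partial_sums:
  fixes a :: "nat \<Rightarrow> complex" and y :: real
  assumes B: "\<And>N. cmod (\<Sum>n<N. a n) \<le> B" and B0: "B \<ge> 0"
  shows "summable (\<lambda>n. a n * of_real (real (Suc n) / ((real (Suc n))\<^sup>2 + y\<^sup>2)))"
    and "cmod (\<Sum>n<N. a n * of_real (real (Suc n) / ((real (Suc n))\<^sup>2 + y\<^sup>2))) \<le> 2 * B"
proof -
  define d1 d2 where "d1 n = 1 / real (Suc n)" and "d2 n = 1 / (real (Suc n) ^ 1 * ((real (Suc n))\<^sup>2 + y\<^sup>2))" for n
  have d1: "decseq d1" "d1 \<longlonglongrightarrow> 0"
    unfolding d1_def using LIMSEQ_inverse_real_of_nat
    by (auto simp: inverse_eq_divide intro!: decseq_SucI divide_left_mono)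
  have d2: "decseq d2" "d2 \<longlonglongrightarrow> 0"
    unfolding d2_def by (rule decseq_power_sum tendsto_power_sum)+
  have eq: "a n * of_real (real (Suc n) / ((real (Suc n))\<^sup>2 + y\<^sup>2))
      = a n * of_real (d1 n) - of_real (y\<^sup>2) * (a n * of_real (d2 n))" for n
  proof -
    have "real (Suc n) \<noteq> 0" "(real (Suc n))\<^sup>2 + y\<^sup>2 \<noteq> 0"
      using add_pos_nonneg[of "(real (Suc n))\<^sup>2" "y\<^sup>2"] by auto
    then have "real (Suc n) / ((real (Suc n))\<^sup>2 + y\<^sup>2) = d1 n - y\<^sup>2 * d2 n"
      unfolding d1_def d2_def by (simp add: divide_simps del: of_nat_Suc) (simp add: power2_eq_square algebra_simps)
    then show ?thesis
      by (simp only: of_real_diff of_real_mult right_diff_distrib mult.left_commute)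
  qed
  show "summable (\<lambda>n. a n * of_real (real (Suc n) / ((real (Suc n))\<^sup>2 + y\<^sup>2)))"
    unfolding eq by (intro summable_diff summable_mult Dirichlet_test_summable[OF d1 B] Dirichlet_test_summable[OF d2 B])
  have "cmod (\<Sum>n<N. a n * of_real (d1 n)) \<le> B * d1 0"
    by (rule Dirichlet_test_bound[OF d1 B])
  moreover have "cmod (of_real (y\<^sup>2) * (\<Sum>n<N. a n * of_real (d2 n))) \<le> y\<^sup>2 * (B * d2 0)"
    unfolding norm_mult norm_of_real abs_power2 using Dirichlet_test_bound[OF d2 B]
    by (intro mult_left_mono) auto
  moreover have "y\<^sup>2 * (B * d2 0) \<le> B"
  proof -
    have "y\<^sup>2 * d2 0 \<le> 1" by (simp add: d2_def add_pos_nonneg)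
    then show ?thesis using B0 mult_left_mono[of "y\<^sup>2 * d2 0" 1 B] by (simp add: algebra_simps)
  qed
  moreover have "B * d1 0 = B" by (simp add: d1_def)
  ultimately show "cmod (\<Sum>n<N. a n * of_real (real (Suc n) / ((real (Suc n))\<^sup>2 + y\<^sup>2))) \<le> 2 * B"
    unfolding eq sum_subtractf sum_distrib_left[symmetric]
    using norm_triangle_ineq4[of "\<Sum>n<N. a n * of_real (d1 n)" "of_real (y\<^sup>2) * (\<Sum>n<N. a n * of_real (d2 n))"]
    by linarith
qed

text \<open>The decay in \<open>y\<close> is the point: at \<open>y = pi * k / \<alpha>\<close> it
  provides the factor \<open>1 / k^2\<close> that makes the outer sum converge for
  \<open>q = 0\<close>.\<close>

lemma even_partial_sums:
  fixes a :: "nat \<Rightarrow> complex" and y :: real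
  assumes B: "\<And>N. cmod (\<Sum>n<N. a n) \<le> B" and B0: "B \<ge> 0" and y: "y > 0"
  shows "cmod (\<Sum>n<N. a n * of_real (1 / ((real (Suc n))\<^sup>2 + y\<^sup>2))) \<le> B / y\<^sup>2"
proof -
  have "cmod (\<Sum>n<N. a n * of_real (1 / ((real (Suc n))\<^sup>2 + y\<^sup>2))) \<le> B * (1 / (1 + y\<^sup>2))"
    using Dirichlet_test_bound[OF decseq_power_sum[of 0 y] tendsto_power_sum[of 0 y] B] by simp
  also have "\<dots> \<le> B * (1 / y\<^sup>2)"
    using B0 y by (intro mult_left_mono divide_left_mono mult_pos_pos add_pos_pos) auto
  finally show ?thesis by simp
qed

lemma summable_inverse_power:
  assumes "e \<ge> 2"
  shows "summable (\<lambda>n. 1 / real (Suc n) ^ e)"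
  using inverse_power_summable[OF assms, where 'a = real]
  by (subst summable_Suc_iff[of "\<lambda>n. 1 / real n ^ e"]) (simp add: inverse_eq_divide)

text \<open>Serves even \<open>g\<close> of arbitrary mean, for which the partial sums of the
  coefficients may grow. The bound does not decay in \<open>y\<close>, but for \<open>q > 0\<close>
  the outer weights are summable by themselves.\<close>

lemma bounded_partial_sums:
  fixes a :: "nat \<Rightarrow> complex" and y :: real
  assumes B: "\<And>n. cmod (a n) \<le> B"
  shows "summable (\<lambda>n. a n * of_real (1 / ((real (Suc n))\<^sup>2 + y\<^sup>2)))"
    and "cmod (\<Sum>n<N. a n * of_real (1 / ((real (Suc n))\<^sup>2 + y\<^sup>2))) \<le> B * (\<Sum>n. 1 / real (Suc n) ^ 2)"
proof -
  have B0: "B \<ge> 0" using order.trans[OF norm_ge_zero B] .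
  have le: "cmod (a n * of_real (1 / ((real (Suc n))\<^sup>2 + y\<^sup>2))) \<le> B * (1 / real (Suc n) ^ 2)" for n
  proof -
    have "1 / ((real (Suc n))\<^sup>2 + y\<^sup>2) \<le> 1 / (real (Suc n))\<^sup>2"
      by (intro divide_left_mono mult_pos_pos add_pos_nonneg) auto
    then show ?thesis
      using B[of n] B0 unfolding norm_mult norm_of_real by (intro mult_mono) auto
  qed
  have s: "summable (\<lambda>n. B * (1 / real (Suc n) ^ 2))"
    by (intro summable_mult summable_inverse_power) simp
  show "summable (\<lambda>n. a n * of_real (1 / ((real (Suc n))\<^sup>2 + y\<^sup>2)))"
    using s le by (rule summable_comparison_test'[where N = 0])
  have "cmod (\<Sum>n<N. a n * of_real (1 / ((real (Suc n))\<^sup>2 + y\<^sup>2))) \<le> (\<Sum>n<N. B * (1 / real (Suc n) ^ 2))"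
    using le by (intro sum_norm_le)
  also have "\<dots> \<le> (\<Sum>n. B * (1 / real (Suc n) ^ 2))"
    using B0 by (intro sum_le_suminf s) auto
  also have "\<dots> = B * (\<Sum>n. 1 / real (Suc n) ^ 2)"
    by (intro suminf_mult summable_inverse_power) simp
  finally show "cmod (\<Sum>n<N. a n * of_real (1 / ((real (Suc n))\<^sup>2 + y\<^sup>2))) \<le> B * (\<Sum>n. 1 / real (Suc n) ^ 2)" .
qed

section \<open>Evaluation of the inner sums and of the hyperbolic cotangent\<close>

lemma odd_quadratic_sums:
  fixes g :: "int \<Rightarrow> complex"
  assumes m: "m > 0" and per: "\<And>n. g (n + int m) = g n" and odd: "\<And>n. g (- n) = - g n" and y: "y > 0"
  shows "(\<lambda>n. g (int (Suc n)) * of_real (real (Suc n) / ((real (Suc n))\<^sup>2 + y\<^sup>2))) sums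
    ((\<Sum>r<m. g (int r) * of_real (pi / real m * (sin (2 * pi * real r / real m)
        / (cosh (2 * pi * y / real m) - cos (2 * pi * real r / real m))))) / 2)"
proof -
  define \<phi> where "\<phi> n = complex_of_int n / of_real (of_int n ^ 2 + y\<^sup>2)" for n :: int
  have eq: "g (int (Suc n)) * of_real (real (Suc n) / ((real (Suc n))\<^sup>2 + y\<^sup>2))
      = g (int (Suc n)) * \<phi> (int (Suc n))" for n
    by (simp add: \<phi>_def)
  obtain B where B: "\<And>N. cmod (\<Sum>n<N. g (int (Suc n))) \<le> B" "B \<ge> 0"
    using periodic_partial_sums_bounded[of m g, OF m per odd_periodic_sum_eq_0[of g m, OF per odd]] by blast
  have "(\<lambda>n. \<phi> (int n)) \<longlonglongrightarrow> 0"
  proof -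
    have "(\<lambda>n. complex_of_real (real (Suc n) / ((real (Suc n))\<^sup>2 + y\<^sup>2))) \<longlonglongrightarrow> of_real 0"
      by (intro tendsto_of_real) real_asymp
    then have "(\<lambda>n. \<phi> (int (Suc n))) \<longlonglongrightarrow> 0" by (simp add: \<phi>_def)
    then show ?thesis by (rule LIMSEQ_imp_Suc)
  qed
  then have "(\<lambda>n. g (int (Suc n)) * \<phi> (int (Suc n))) sums (((\<Sum>r<m. g (int r) *
      of_real (pi / real m * (sin (2 * pi * real r / real m)
        / (cosh (2 * pi * y / real m) - cos (2 * pi * real r / real m))))) - g 0 * \<phi> 0) / 2)"
  proof (rule periodic_sum_by_residues[where g = g and \<phi> = \<phi>, OF m per, rotated])
    show "summable (\<lambda>n. g (int (Suc n)) * \<phi> (int (Suc n)))"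
      using odd_partial_sums(1)[OF B, of y] by (simp only: eq)
    show "(\<lambda>l. \<phi> (int r + int l * int m) + \<phi> (int r - (int l + 1) * int m)) sums
       of_real (pi / real m * (sin (2 * pi * real r / real m)
        / (cosh (2 * pi * y / real m) - cos (2 * pi * real r / real m))))" for r
      unfolding \<phi>_def by (rule sums_residue_class_odd[OF m y])
    show "g (- n) * \<phi> (- n) = g n * \<phi> n" for n
      by (simp add: odd \<phi>_def)
  qed
  \<comment> \<open>The odd kernel has no summand at 0. The even one contributes
    \<open>g 0 / y^2\<close> there, which is the source of the term with
    \<open>L(0, g)\<close>.\<close>
  moreover have "\<phi> 0 = 0" by (simp add: \<phi>_def)
  ultimately show ?thesis unfolding eq by simp
qed

lemma even_quadratic_sums:
  fixes g :: "int \<Rightarrow> complex"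
  assumes m: "m > 0" and per: "\<And>n. g (n + int m) = g n" and even: "\<And>n. g (- n) = g n" and y: "y > 0"
  shows "(\<lambda>n. g (int (Suc n)) * of_real (1 / ((real (Suc n))\<^sup>2 + y\<^sup>2))) sums
    (((\<Sum>r<m. g (int r) * of_real (pi / (real m * y) * (sinh (2 * pi * y / real m)
        / (cosh (2 * pi * y / real m) - cos (2 * pi * real r / real m))))) - g 0 * of_real (1 / y\<^sup>2)) / 2)"
proof -
  define \<phi> where "\<phi> n = 1 / complex_of_real (of_int n ^ 2 + y\<^sup>2)" for n :: int
  have eq: "g (int (Suc n)) * of_real (1 / ((real (Suc n))\<^sup>2 + y\<^sup>2))
      = g (int (Suc n)) * \<phi> (int (Suc n))" for n
    by (simp add: \<phi>_def)
  obtain B where B: "\<And>n. cmod (g n) \<le> B" "B \<ge> 0"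
    using periodic_bounded[of m g, OF m per] by blast
  have "(\<lambda>n. \<phi> (int n)) \<longlonglongrightarrow> 0"
  proof -
    have "(\<lambda>n. complex_of_real (1 / ((real n)\<^sup>2 + y\<^sup>2))) \<longlonglongrightarrow> of_real 0"
      by (intro tendsto_of_real) real_asymp
    then show ?thesis by (simp add: \<phi>_def)
  qed
  then have "(\<lambda>n. g (int (Suc n)) * \<phi> (int (Suc n))) sums (((\<Sum>r<m. g (int r) *
      of_real (pi / (real m * y) * (sinh (2 * pi * y / real m)
        / (cosh (2 * pi * y / real m) - cos (2 * pi * real r / real m))))) - g 0 * \<phi> 0) / 2)"
  proof (rule periodic_sum_by_residues[where g = g and \<phi> = \<phi>, OF m per, rotated])
    show "summable (\<lambda>n. g (int (Suc n)) * \<phi> (int (Suc n)))"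
      using bounded_partial_sums(1)[of "\<lambda>n. g (int (Suc n))" B y] B by (simp only: eq)
    show "(\<lambda>l. \<phi> (int r + int l * int m) + \<phi> (int r - (int l + 1) * int m)) sums
       of_real (pi / (real m * y) * (sinh (2 * pi * y / real m)
        / (cosh (2 * pi * y / real m) - cos (2 * pi * real r / real m))))" for r
      unfolding \<phi>_def by (rule sums_residue_class_even[OF m y])
    show "g (- n) * \<phi> (- n) = g n * \<phi> n" for n
      by (simp add: even \<phi>_def)
  qed
  moreover have "\<phi> 0 = of_real (1 / y\<^sup>2)" by (simp add: \<phi>_def)
  ultimately show ?thesis unfolding eq by simp
qed

text \<open>The even evaluation for the constant function 1 with period 1, at
  \<open>y = x / pi\<close>. There \<open>C\<close> is \<open>coth x\<close>, and
  \<open>1 / (2 * x)\<close> is the summand at 0.\<close>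

lemma coth_partial_fractions:
  fixes x :: real
  assumes x: "x > 0"
  shows "(\<lambda>k. x / (x\<^sup>2 + (pi * real (Suc k))\<^sup>2)) sums (1 / 2 + 1 / (exp (2 * x) - 1) - 1 / (2 * x))"
proof -
  define C where "C = sinh (2 * x) / (cosh (2 * x) - 1)"
  have E: "exp (2 * x) > 1" using x by simp
  have C: "C = 1 + 2 / (exp (2 * x) - 1)"
  proof -
    define E where "E = exp (2 * x)"
    have ex: "exp (2 * x) = E" "exp (- (2 * x)) = 1 / E"
      by (simp_all add: E_def exp_minus inverse_eq_divide)
    have "E > 1" using E by (simp add: E_def)
    then have "E - 1 \<noteq> 0" "E \<noteq> 0" by auto
    have "sinh (2 * x) = (E\<^sup>2 - 1) / (2 * E)" "cosh (2 * x) - 1 = (E - 1)\<^sup>2 / (2 * E)"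
      using \<open>E \<noteq> 0\<close> unfolding sinh_field_def cosh_field_def ex by (simp_all add: field_simps power2_eq_square)
    then have "C = (E\<^sup>2 - 1) / (E - 1)\<^sup>2"
      using \<open>E \<noteq> 0\<close> by (simp add: C_def)
    also have "\<dots> = (E + 1) / (E - 1)"
      using \<open>E - 1 \<noteq> 0\<close> by (simp add: divide_simps) (simp add: power2_eq_square algebra_simps)
    also have "\<dots> = 1 + 2 / (E - 1)"
      using \<open>E - 1 \<noteq> 0\<close> by (simp add: field_simps)
    finally show ?thesis by (simp add: E_def)
  qed
  have "(\<lambda>n. complex_of_real (1 / ((real (Suc n))\<^sup>2 + (x / pi)\<^sup>2))) sums
     of_real ((pi / (x / pi) * C - 1 / (x / pi)\<^sup>2) / 2)"
    using even_quadratic_sums[of 1 "\<lambda>_. 1" "x / pi"] x by (simp add: C_def)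
  then have "(\<lambda>n. 1 / ((real (Suc n))\<^sup>2 + (x / pi)\<^sup>2)) sums ((pi / (x / pi) * C - 1 / (x / pi)\<^sup>2) / 2)"
    by (simp only: sums_of_real_iff)
  then have "(\<lambda>n. x / pi\<^sup>2 * (1 / ((real (Suc n))\<^sup>2 + (x / pi)\<^sup>2))) sums (C / 2 - 1 / (2 * x))"
  proof -
    have "x / pi\<^sup>2 * ((pi / (x / pi) * C - 1 / (x / pi)\<^sup>2) / 2) = C / 2 - 1 / (2 * x)"
      using x by (simp add: field_simps power2_eq_square)
    then show ?thesis
      using sums_mult[OF \<open>_ sums ((pi / (x / pi) * C - 1 / (x / pi)\<^sup>2) / 2)\<close>, of "x / pi\<^sup>2"] by (simp only:)
  qed
  moreover have "x / pi\<^sup>2 * (1 / ((real (Suc n))\<^sup>2 + (x / pi)\<^sup>2)) = x / (x\<^sup>2 + (pi * real (Suc n))\<^sup>2)" for n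
  proof -
    have "pi\<^sup>2 * ((real (Suc n))\<^sup>2 + (x / pi)\<^sup>2) = x\<^sup>2 + (pi * real (Suc n))\<^sup>2"
      by (simp add: power_mult_distrib power_divide distrib_left del: of_nat_Suc)
    then show ?thesis by (metis times_divide_times_eq mult.right_neutral)
  qed
  moreover have "C / 2 - 1 / (2 * x) = 1 / 2 + 1 / (exp (2 * x) - 1) - 1 / (2 * x)"
  proof -
    have "(1 + 2 / D) / 2 = 1 / 2 + 1 / D" for D :: real by (simp add: add_divide_distrib)
    then show ?thesis unfolding C by (simp only:)
  qed
  ultimately show ?thesis by (simp only:)
qed

section \<open>Expansion of the hyperbolic cotangent series\<close>

lemma dirichlet_L_of_nat_sums:
  fixes g :: "int \<Rightarrow> complex"
  assumes m: "m > 0" and per: "\<And>n. g (n + int m) = g n"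
    and e: "e \<ge> 2 \<or> e \<ge> 1 \<and> (\<Sum>r<m. g (int r)) = 0"
  shows "(\<lambda>n. g (int (Suc n)) * of_real (1 / real (Suc n) ^ e)) sums dirichlet_L (of_nat e) g"
proof -
  have eq: "dirichlet_term (of_nat e) g n = g (int (Suc n)) * of_real (1 / real (Suc n) ^ e)" for n
    by (simp add: dirichlet_term_def powr_minus_divide powr_nat' del: of_nat_Suc)
  have "summable (\<lambda>n. g (int (Suc n)) * of_real (1 / real (Suc n) ^ e))"
    using e
  proof
    assume e: "e \<ge> 2"
    obtain B where B: "\<And>n. cmod (g n) \<le> B" "B \<ge> 0"
      using periodic_bounded[of m g, OF m per] by blast
    have "summable (\<lambda>n. B * (1 / real (Suc n) ^ e))"
      by (intro summable_mult summable_inverse_power e)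
    then show ?thesis
    proof (rule summable_comparison_test'[where N = 0])
      show "cmod (g (int (Suc n)) * of_real (1 / real (Suc n) ^ e)) \<le> B * (1 / real (Suc n) ^ e)" for n
        using B unfolding norm_mult norm_of_real by (intro mult_mono) auto
    qed
  next
    assume e: "e \<ge> 1 \<and> (\<Sum>r<m. g (int r)) = 0"
    then obtain B where B: "\<And>N. cmod (\<Sum>n<N. g (int (Suc n))) \<le> B"
      using periodic_partial_sums_bounded[of m g, OF m per] by blast
    show ?thesis
    proof (rule Dirichlet_test_summable[OF _ _ B])
      show "decseq (\<lambda>n. 1 / real (Suc n) ^ e)"
        by (intro decseq_SucI divide_left_mono power_mono mult_pos_pos) auto
      show "(\<lambda>n. 1 / real (Suc n) ^ e) \<longlonglongrightarrow> 0"
        using e LIMSEQ_inverse_real_of_nat[THEN tendsto_power, of e]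
        by (simp add: inverse_eq_divide power_one_over power_0_left)
    qed
  qed
  then show ?thesis
    unfolding dirichlet_L_def eq[abs_def] by (simp add: summable_sums)
qed

lemma zeta_sums:
  assumes "e \<ge> 2"
  shows "(\<lambda>n. complex_of_real (1 / real (Suc n) ^ e)) sums zeta (of_nat e)"
  using dirichlet_L_of_nat_sums[of 1 "\<lambda>_. 1" e] assms by (simp add: zeta_def)

lemma zeta_0: "zeta 0 = - 1 / 2"
  using dirichlet_L_0[of 1 "\<lambda>_. 1"] by (simp add: zeta_def)

lemma geometric_partial_fractions:
  fixes A b :: real
  assumes "b \<noteq> 0" "A + b \<noteq> 0"
  shows "1 / (A + b) = (\<Sum>i<q. (- A) ^ i / b ^ Suc i) + (- A / b) ^ q / (A + b)"
proof (induction q)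
  case (Suc q)
  have "(- A) ^ q / b ^ Suc q + (- A / b) ^ Suc q / (A + b) = (- A / b) ^ q * (1 / b + (- A / b) / (A + b))"
  proof -
    have "(- A) ^ q / b ^ Suc q = (- A / b) ^ q * (1 / b)"
      unfolding power_divide by simp
    moreover have "(- A / b) ^ Suc q / (A + b) = (- A / b) ^ q * ((- A / b) / (A + b))"
      by simp
    ultimately show ?thesis by (simp only: distrib_left)
  qed
  also have "1 / b + (- A / b) / (A + b) = 1 / (A + b)"
  proof -
    have "(1 / b + (- A / b) / (A + b)) * (A + b) = 1"
      using assms by (simp add: left_diff_distrib distrib_right add_divide_distrib)
    then show ?thesis using assms by (simp add: eq_divide_eq)
  qed
  finally show ?case
    unfolding sum.lessThan_Suc add.assoc by (simp only: times_divide_eq_right mult_1_right Suc.IH[symmetric])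
qed simp

text \<open>Here \<epsilon> encodes the parity, 0 for even and 1 for odd \<open>g\<close>. Each
  geometric step trades a factor \<open>1 / N^2\<close> for \<open>1 / K^2\<close>; after
  \<open>q\<close> steps the remainder depends on \<open>N\<close> only through the kernel
  \<open>N ^ \<epsilon> / ((\<alpha> * N)^2 + (pi * K)^2)\<close>, whose sums over \<open>N\<close>
  are known in closed form.\<close>

lemma coth_summand_expansion:
  fixes \<alpha> N K :: real
  assumes "\<alpha> > 0" "N > 0" "K > 0" "\<epsilon> \<le> (1::nat)"
  shows "1 / N ^ (2 * q + 1 - \<epsilon>) * (\<alpha> * N / ((\<alpha> * N)\<^sup>2 + (pi * K)\<^sup>2))
    = (\<Sum>i<q. (- 1) ^ i * \<alpha> ^ (2 * i + 1) / pi ^ (2 * i + 2) / N ^ (2 * (q - Suc i) + 2 - \<epsilon>) * (1 / K ^ (2 * Suc i)))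
      + \<alpha> * (- 1) ^ q * (\<alpha> / pi) ^ (2 * q) * (N ^ \<epsilon> / ((\<alpha> * N)\<^sup>2 + (pi * K)\<^sup>2) / K ^ (2 * q))"
proof -
  define A b where "A = (\<alpha> * N)\<^sup>2" and "b = (pi * K)\<^sup>2"
  have pos: "A > 0" "b > 0" using assms by (simp_all add: A_def b_def)
  have N: "N ^ (2 * q + 1 - \<epsilon>) = N ^ (2 * q + 1) / N ^ \<epsilon>"
    using assms by (intro power_diff) auto
  have "1 / N ^ (2 * q + 1 - \<epsilon>) * (\<alpha> * N / (A + b)) = \<alpha> * N ^ \<epsilon> / N ^ (2 * q) * (1 / (A + b))"
  proof -
    have "A + b \<noteq> 0" "N ^ (2 * q) \<noteq> 0" "N ^ (2 * q + 1) = N * N ^ (2 * q)"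
      using pos assms by auto
    then show ?thesis
      unfolding N using assms by (simp add: divide_simps)
  qed
  also have "\<dots> = (\<Sum>i<q. \<alpha> * N ^ \<epsilon> / N ^ (2 * q) * ((- A) ^ i / b ^ Suc i))
      + \<alpha> * N ^ \<epsilon> / N ^ (2 * q) * ((- A / b) ^ q / (A + b))"
    using geometric_partial_fractions[of b A q] pos by (simp only: distrib_left sum_distrib_left)
  also have "(\<Sum>i<q. \<alpha> * N ^ \<epsilon> / N ^ (2 * q) * ((- A) ^ i / b ^ Suc i))
     = (\<Sum>i<q. (- 1) ^ i * \<alpha> ^ (2 * i + 1) / pi ^ (2 * i + 2) / N ^ (2 * (q - Suc i) + 2 - \<epsilon>) * (1 / K ^ (2 * Suc i)))"
  proof (rule sum.cong[OF refl])
    fix i assume "i \<in> {..<q}"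
    then have i: "i < q" by simp
    then have "2 * (q - Suc i) + 2 - \<epsilon> = 2 * (q - i) - \<epsilon>" by simp
    also have "N ^ \<dots> = N ^ (2 * (q - i)) / N ^ \<epsilon>"
      using assms i by (intro power_diff) auto
    also have "2 * (q - i) = 2 * q - 2 * i" by simp
    also have "N ^ \<dots> = N ^ (2 * q) / N ^ (2 * i)"
      using assms i by (intro power_diff) auto
    finally have E: "N ^ (2 * (q - Suc i) + 2 - \<epsilon>) = N ^ (2 * q) / N ^ (2 * i) / N ^ \<epsilon>" .
    have "(- A) ^ i = (- 1) ^ i * \<alpha> ^ (2 * i) * N ^ (2 * i)"
      by (subst power_minus) (simp add: A_def power_mult_distrib power_mult)
    moreover have "b ^ Suc i = pi ^ (2 * i + 2) * K ^ (2 * Suc i)"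
      unfolding b_def power_mult[symmetric] power_mult_distrib by simp
    ultimately show "\<alpha> * N ^ \<epsilon> / N ^ (2 * q) * ((- A) ^ i / b ^ Suc i)
      = (- 1) ^ i * \<alpha> ^ (2 * i + 1) / pi ^ (2 * i + 2) / N ^ (2 * (q - Suc i) + 2 - \<epsilon>) * (1 / K ^ (2 * Suc i))"
      unfolding E using assms by (simp add: divide_simps)
  qed
  also have "\<alpha> * N ^ \<epsilon> / N ^ (2 * q) * ((- A / b) ^ q / (A + b))
     = \<alpha> * (- 1) ^ q * (\<alpha> / pi) ^ (2 * q) * (N ^ \<epsilon> / (A + b) / K ^ (2 * q))"
  proof -
    have "- A / b = - 1 * (\<alpha> / pi)\<^sup>2 * N\<^sup>2 / K\<^sup>2"
      by (simp add: A_def b_def power_mult_distrib power_divide)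
    then have "(- A / b) ^ q = (- 1) ^ q * (\<alpha> / pi) ^ (2 * q) * N ^ (2 * q) / K ^ (2 * q)"
      by (simp only: power_divide power_mult_distrib power_mult)
    then show ?thesis using assms by (simp add: divide_simps)
  qed
  finally show ?thesis unfolding A_def b_def .
qed

text \<open>Only the double series of remainders is exchanged. The \<open>q\<close> explicit powers
  form a finite sum of products, so their series over \<open>n\<close> and over \<open>k\<close> are
  evaluated separately, without rearrangement.\<close>

lemma coth_dirichlet_series_sums:
  fixes a :: "nat \<Rightarrow> complex" and \<alpha> :: real and \<epsilon> q :: nat and Z :: "nat \<Rightarrow> real"
  defines "\<phi> \<equiv> \<lambda>n k. real (Suc n) ^ \<epsilon> / ((\<alpha> * real (Suc n))\<^sup>2 + (pi * real (Suc k))\<^sup>2)"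
  assumes \<alpha>: "\<alpha> > 0" and \<epsilon>: "\<epsilon> \<le> 1"
    and col: "\<And>k. (\<lambda>n. a n * of_real (\<phi> n k)) sums G k"
    and bound: "\<And>N k. cmod (\<Sum>n<N. a n * of_real (\<phi> n k)) / real (Suc k) ^ (2 * q) \<le> h k"
    and h: "summable h"
    and \<Lambda>: "\<And>j. j \<le> q \<Longrightarrow> (\<lambda>n. a n * of_real (1 / real (Suc n) ^ (2 * (q - j) + 2 - \<epsilon>))) sums \<Lambda> j"
    and Z: "\<And>i. i < q \<Longrightarrow> (\<lambda>k. 1 / real (Suc k) ^ (2 * Suc i)) sums Z (Suc i)"
  shows "(\<lambda>n. a n * of_real ((1 / 2 + 1 / (exp (2 * (\<alpha> * real (Suc n))) - 1)) / real (Suc n) ^ (2 * q + 1 - \<epsilon>)))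
    sums (of_real (1 / (2 * \<alpha>)) * \<Lambda> 0
      + (\<Sum>i<q. of_real ((- 1) ^ i * \<alpha> ^ (2 * i + 1) / pi ^ (2 * i + 2) * Z (Suc i)) * \<Lambda> (Suc i))
      + of_real (\<alpha> * (- 1) ^ q * (\<alpha> / pi) ^ (2 * q)) * (\<Sum>k. G k * of_real (1 / real (Suc k) ^ (2 * q))))"
proof -
  define c where "c = \<alpha> * (- 1) ^ q * (\<alpha> / pi) ^ (2 * q)"
  have c: "c \<noteq> 0" using \<alpha> by (simp add: c_def)
  define \<kappa> where "\<kappa> i = (- 1) ^ i * \<alpha> ^ (2 * i + 1) / pi ^ (2 * i + 2)" for i
  define E where "E j = 2 * (q - j) + 2 - \<epsilon>" for j
  define W where "W n = (1 / 2 + 1 / (exp (2 * (\<alpha> * real (Suc n))) - 1)) / real (Suc n) ^ (2 * q + 1 - \<epsilon>)" for n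
  \<comment> \<open>The \<open>n\<close>-th expansion solved for its remainder: as \<open>c\<close>
    is nonzero, \<open>R n\<close> is the sum of the \<open>n\<close>-th row of the double series in
    closed form.\<close>
  define R where "R n = 1 / c * (W n - 1 / (2 * \<alpha>) * (1 / real (Suc n) ^ E 0)
      - (\<Sum>i<q. \<kappa> i * Z (Suc i) * (1 / real (Suc n) ^ E (Suc i))))" for n
  have row: "(\<lambda>k. \<phi> n k / real (Suc k) ^ (2 * q)) sums R n" for n
  proof -
    define N where "N = real (Suc n)"
    have N: "N > 0" by (simp add: N_def)
    have "(\<lambda>k. 1 / c * (1 / N ^ (2 * q + 1 - \<epsilon>) * (\<alpha> * N / ((\<alpha> * N)\<^sup>2 + (pi * real (Suc k))\<^sup>2))
        - (\<Sum>i<q. \<kappa> i / N ^ E (Suc i) * (1 / real (Suc k) ^ (2 * Suc i)))))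
      sums (1 / c * (1 / N ^ (2 * q + 1 - \<epsilon>) * (1 / 2 + 1 / (exp (2 * (\<alpha> * N)) - 1) - 1 / (2 * (\<alpha> * N)))
        - (\<Sum>i<q. \<kappa> i / N ^ E (Suc i) * Z (Suc i))))"
      using \<alpha> N by (intro sums_mult sums_diff sums_sum coth_partial_fractions Z) auto
    moreover have "1 / c * (1 / N ^ (2 * q + 1 - \<epsilon>) * (\<alpha> * N / ((\<alpha> * N)\<^sup>2 + (pi * real (Suc k))\<^sup>2))
        - (\<Sum>i<q. \<kappa> i / N ^ E (Suc i) * (1 / real (Suc k) ^ (2 * Suc i)))) = \<phi> n k / real (Suc k) ^ (2 * q)" for k
    proof -
      have "1 / N ^ (2 * q + 1 - \<epsilon>) * (\<alpha> * N / ((\<alpha> * N)\<^sup>2 + (pi * real (Suc k))\<^sup>2))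
          - (\<Sum>i<q. \<kappa> i / N ^ E (Suc i) * (1 / real (Suc k) ^ (2 * Suc i))) = c * (\<phi> n k / real (Suc k) ^ (2 * q))"
        unfolding \<kappa>_def c_def \<phi>_def N_def[symmetric] E_def
        using coth_summand_expansion[of \<alpha> N "real (Suc k)" \<epsilon> q] \<alpha> \<epsilon> N by linarith
      then show ?thesis using c by (simp only:) simp
    qed
    moreover have "1 / c * (1 / N ^ (2 * q + 1 - \<epsilon>) * (1 / 2 + 1 / (exp (2 * (\<alpha> * N)) - 1) - 1 / (2 * (\<alpha> * N)))
        - (\<Sum>i<q. \<kappa> i / N ^ E (Suc i) * Z (Suc i))) = R n"
    proof -
      have "E 0 = Suc (2 * q + 1 - \<epsilon>)" using \<epsilon> by (simp add: E_def)
      then have "1 / N ^ (2 * q + 1 - \<epsilon>) * (1 / (2 * (\<alpha> * N))) = 1 / (2 * \<alpha>) * (1 / N ^ E 0)"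
        by simp
      then show ?thesis
        unfolding R_def W_def N_def[symmetric] by (simp add: right_diff_distrib mult.commute)
    qed
    ultimately show ?thesis by (simp only:)
  qed
  have dbl: "(\<lambda>n. \<Sum>k. a n * of_real (\<phi> n k / real (Suc k) ^ (2 * q))) sums
     (\<Sum>k. G k * of_real (1 / real (Suc k) ^ (2 * q)))"
  proof (rule suminf_swap_dominated)
    have eq: "a n * of_real (\<phi> n k / real (Suc k) ^ (2 * q)) = (a n * of_real (\<phi> n k)) * of_real (1 / real (Suc k) ^ (2 * q))" for n k
      by simp
    show "summable (\<lambda>k. a n * of_real (\<phi> n k / real (Suc k) ^ (2 * q)))" for n
      using row[of n] by (intro summable_mult summable_of_real) (simp add: sums_iff)
    show "(\<lambda>n. a n * of_real (\<phi> n k / real (Suc k) ^ (2 * q))) sums (G k * of_real (1 / real (Suc k) ^ (2 * q)))" for k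
      unfolding eq by (intro sums_mult2 col)
    show "cmod (\<Sum>n<N. a n * of_real (\<phi> n k / real (Suc k) ^ (2 * q))) \<le> h k" for N k
      unfolding eq sum_distrib_right[symmetric] norm_mult using bound[of k N]
      by (simp add: norm_divide norm_power del: of_nat_Suc)
  qed (rule h)
  have "(\<Sum>k. a n * of_real (\<phi> n k / real (Suc k) ^ (2 * q))) = a n * of_real (R n)" for n
    using sums_mult[OF sums_of_real[OF row[of n]], of "a n"] by (rule sums_unique[symmetric])
  with dbl have dbl': "(\<lambda>n. a n * of_real (R n)) sums (\<Sum>k. G k * of_real (1 / real (Suc k) ^ (2 * q)))"
    by simp
  have "(\<lambda>n. of_real (1 / (2 * \<alpha>)) * (a n * of_real (1 / real (Suc n) ^ E 0))
      + (\<Sum>i<q. of_real (\<kappa> i * Z (Suc i)) * (a n * of_real (1 / real (Suc n) ^ E (Suc i))))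
      + of_real c * (a n * of_real (R n)))
    sums (of_real (1 / (2 * \<alpha>)) * \<Lambda> 0 + (\<Sum>i<q. of_real (\<kappa> i * Z (Suc i)) * \<Lambda> (Suc i))
      + of_real c * (\<Sum>k. G k * of_real (1 / real (Suc k) ^ (2 * q))))"
    unfolding E_def by (intro sums_add sums_mult sums_sum \<Lambda> dbl') auto
  moreover have "of_real (1 / (2 * \<alpha>)) * (a n * of_real (1 / real (Suc n) ^ E 0))
      + (\<Sum>i<q. of_real (\<kappa> i * Z (Suc i)) * (a n * of_real (1 / real (Suc n) ^ E (Suc i))))
      + of_real c * (a n * of_real (R n)) = a n * of_real (W n)" for n
  proof -
    have "W n = 1 / (2 * \<alpha>) * (1 / real (Suc n) ^ E 0) + (\<Sum>i<q. \<kappa> i * Z (Suc i) * (1 / real (Suc n) ^ E (Suc i))) + c * R n"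
      unfolding R_def using c by simp
    then have "a n * of_real (W n) = a n * (of_real (1 / (2 * \<alpha>)) * of_real (1 / real (Suc n) ^ E 0)
        + (\<Sum>i<q. of_real (\<kappa> i * Z (Suc i)) * of_real (1 / real (Suc n) ^ E (Suc i))) + of_real c * of_real (R n))"
      by (simp only: of_real_add of_real_mult of_real_sum)
    then show ?thesis
      by (simp only: distrib_left sum_distrib_left mult.left_commute)
  qed
  ultimately show ?thesis
    unfolding W_def \<kappa>_def c_def by (simp only:)
qed

section \<open>Convergence of the dual series\<close>

lemma cosh_minus_one_ge:
  fixes x :: real
  assumes "x \<ge> 0"
  shows "x\<^sup>2 / 4 \<le> cosh x - 1"
proof -
  have "1 + x + x\<^sup>2 / 2 \<le> exp x"
    using assms by (rule exp_lower_Taylor_quadratic)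
  moreover have "1 - x \<le> exp (- x)"
    using exp_ge_add_one_self[of "- x"] by simp
  moreover have "s / 4 \<le> (e + e') / 2 - 1" if "1 + x + s / 2 \<le> e" "1 - x \<le> e'" for s e e' :: real
    using that by argo
  ultimately show ?thesis unfolding cosh_field_def by blast
qed

lemma cosh_minus_cos_bound:
  fixes t x :: real
  assumes "x > 0"
  shows "cosh x - cos t > 0" "1 / (cosh x - cos t) \<le> 4 / x\<^sup>2"
proof -
  have le: "x\<^sup>2 / 4 \<le> cosh x - cos t"
    using cosh_minus_one_ge[of x] assms cos_le_one[of t] by linarith
  moreover have "x\<^sup>2 / 4 > 0" using assms by simp
  ultimately show "cosh x - cos t > 0" by linarith
  have "1 / (cosh x - cos t) \<le> 1 / (x\<^sup>2 / 4)"
    using le assms \<open>cosh x - cos t > 0\<close> by (intro divide_left_mono mult_pos_pos) auto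
  then show "1 / (cosh x - cos t) \<le> 4 / x\<^sup>2" by simp
qed

text \<open>The quadratic lower bound for \<open>cosh x - cos t\<close> holds uniformly in
  \<open>t\<close>, so the denominator alone supplies \<open>1 / n^2\<close> and every exponent
  \<open>e\<close> is admissible.\<close>

lemma summable_over_cosh_minus_cos:
  fixes u :: "nat \<Rightarrow> real"
  assumes b: "b > 0" and u: "\<And>n. \<bar>u n\<bar> \<le> C"
  shows "summable (\<lambda>n. u n / (cosh (b * real (Suc n)) - cos t) / real (Suc n) ^ e)"
proof -
  have C: "C \<ge> 0" using order.trans[OF abs_ge_zero u] .
  have "summable (\<lambda>n. C * (4 / b\<^sup>2) * (1 / real (Suc n) ^ 2))"
    by (intro summable_mult summable_inverse_power) simp
  then show ?thesis
  proof (rule summable_comparison_test'[where N = 0])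
    fix n
    let ?D = "cosh (b * real (Suc n)) - cos t"
    have D: "?D > 0" "1 / ?D \<le> 4 / (b * real (Suc n))\<^sup>2"
      using cosh_minus_cos_bound[of "b * real (Suc n)" t] b by simp_all
    have "norm (u n / ?D / real (Suc n) ^ e) = \<bar>u n\<bar> * (1 / ?D) * (1 / real (Suc n) ^ e)"
      using D by (simp add: abs_mult del: of_nat_Suc)
    also have "\<dots> \<le> C * (4 / (b * real (Suc n))\<^sup>2) * 1"
      using u[of n] D C by (intro mult_mono) (auto simp: one_le_power)
    also have "\<dots> = C * (4 / b\<^sup>2) * (1 / real (Suc n) ^ 2)"
      by (simp add: power_mult_distrib)
    finally show "norm (u n / ?D / real (Suc n) ^ e) \<le> C * (4 / b\<^sup>2) * (1 / real (Suc n) ^ 2)" .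
  qed
qed

section \<open>The transformation formulas\<close>

lemma sum_atLeast0_atMost_split_first:
  fixes f :: "nat \<Rightarrow> 'a::comm_monoid_add"
  shows "(\<Sum>j=0..q. f j) = f 0 + (\<Sum>i<q. f (Suc i))"
  by (simp add: atLeast0AtMost lessThan_Suc_atMost[symmetric] sum.lessThan_Suc_shift del: sum.lessThan_Suc)

lemma dual_parameter_scaling:
  fixes \<alpha> \<beta> :: real
  assumes "\<alpha> > 0" "\<alpha> * \<beta> = pi\<^sup>2"
  shows "2 * pi * (pi * K / \<alpha>) / m = 2 * K * \<beta> / m"
proof -
  have "\<beta> = pi * pi / \<alpha>" using assms by (simp add: field_simps power2_eq_square)
  then show ?thesis by simp
qed

lemma dirichlet_identity_even:
  fixes m q :: nat and g :: "int \<Rightarrow> complex" and \<alpha> \<beta> :: real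
  assumes m: "m > 0" and per: "\<And>n. g (n + int m) = g n"
    and \<alpha>: "\<alpha> > 0" and \<beta>: "\<beta> > 0" and \<alpha>\<beta>: "\<alpha> * \<beta> = pi\<^sup>2"
    and even: "\<And>n. g (- n) = g n" and q: "q > 0 \<or> period_mean m g = 0"
  shows "of_real (\<alpha> powi (- int q)) *
         (1/2 * dirichlet_L (2 * of_nat q + 1) g
          + (\<Sum>n. g (int (Suc n)) /
                of_real (real (Suc n) ^ (2*q+1) * (exp (2 * real (Suc n) * \<alpha>) - 1))))
       = 1/2 * of_real ((- \<beta>) powi (- int q)) / of_nat m *
           (\<Sum>k=0..<m. g (int k) *
              of_real (\<Sum>n. (cos (2 * pi * real k / real m) - exp (- 2 * real (Suc n) * \<beta> / real m)) /
                (cosh (2 * real (Suc n) * \<beta> / real m) - cos (2 * pi * real k / real m)) /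
                real (Suc n) ^ (2*q+1)))
         + 1/2 * of_real ((- \<beta>) powi (- int q)) *
             (if q = 0 then 0 else period_mean m g * zeta (2 * of_nat q + 1))
         + (\<Sum>j=0..q+1. (-1) ^ (j+1) *
              of_real (\<alpha> powi (int j - int q - 1) * \<beta> powi (- int j)) *
              zeta (2 * of_nat j) * dirichlet_L (2 * of_nat q - 2 * of_nat j + 2) g)"
proof -
  define a where "a n = g (int (Suc n))" for n
  define X where "X k = 2 * real (Suc k) * \<beta> / real m" for k
  define \<theta> where "\<theta> r = 2 * pi * real r / real m" for r
  define C where "C r k = (cos (\<theta> r) - exp (- X k)) / (cosh (X k) - cos (\<theta> r))" for r k
  define V where "V r = (\<Sum>k. C r k / real (Suc k) ^ (2*q+1))" for r
  define y where "y k = pi * real (Suc k) / \<alpha>" for k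
  define S where "S = (\<Sum>r<m. g (int r))"
  have M: "period_mean m g = S / of_nat m" by (simp add: period_mean_def S_def)
  with q m have qS: "q > 0 \<or> S = 0" by simp
  define U where "U = (if q = 0 then 0 else S * zeta (2 * of_nat q + 1))"
  have y: "y k > 0" for k using \<alpha> by (simp add: y_def)
  have X: "X k > 0" for k using \<beta> m by (simp add: X_def)
  have Xy: "2 * pi * y k / real m = X k" for k
    unfolding X_def y_def using dual_parameter_scaling[OF \<alpha> \<alpha>\<beta>] .
  have D: "cosh (X k) - cos (\<theta> r) > 0" for k r
    using cosh_minus_cos_bound(1)[OF X] .
  have V: "(\<lambda>k. C r k / real (Suc k) ^ (2*q+1)) sums V r" for r
  proof -
    have "\<bar>cos (\<theta> r) - exp (- X k)\<bar> \<le> 2" for k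
      using X[of k] cos_le_one[of "\<theta> r"] cos_ge_minus_one[of "\<theta> r"] exp_gt_zero[of "- X k"]
        exp_le_one_iff[of "- X k"] unfolding abs_le_iff by linarith
    then have "summable (\<lambda>k. (cos (\<theta> r) - exp (- X k)) / (cosh (2 * \<beta> / real m * real (Suc k)) - cos (\<theta> r)) / real (Suc k) ^ (2*q+1))"
      using \<beta> m by (intro summable_over_cosh_minus_cos) auto
    moreover have "2 * \<beta> / real m * real (Suc k) = X k" for k by (simp add: X_def)
    ultimately show ?thesis unfolding V_def C_def by (simp add: summable_sums)
  qed
  \<comment> \<open>Separates the limit 1, responsible for the term with \<open>M(g)\<close>, from
    the part that decays in \<open>k\<close>.\<close>
  have C1: "sinh (X k) / (cosh (X k) - cos (\<theta> r)) = 1 + C r k" for r k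
  proof -
    have "sinh (X k) = (cosh (X k) - cos (\<theta> r)) + (cos (\<theta> r) - exp (- X k))"
      using cosh_minus_sinh[of "X k"] by linarith
    then have "sinh (X k) / (cosh (X k) - cos (\<theta> r)) = (cosh (X k) - cos (\<theta> r)) / (cosh (X k) - cos (\<theta> r)) + C r k"
      unfolding C_def by (simp only: add_divide_distrib)
    then show ?thesis
      using D[of k r] by simp
  qed
  have sq: "(\<alpha> * N)\<^sup>2 + (pi * real (Suc k))\<^sup>2 = \<alpha>\<^sup>2 * (N\<^sup>2 + (y k)\<^sup>2)" for N k
    using \<alpha> by (simp add: y_def distrib_left power_mult_distrib power_divide del: of_nat_Suc)
  have term_eq: "a n * of_real (real (Suc n) ^ 0 / ((\<alpha> * real (Suc n))\<^sup>2 + (pi * real (Suc k))\<^sup>2))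
      = a n * of_real (1 / ((real (Suc n))\<^sup>2 + (y k)\<^sup>2)) * of_real (1 / \<alpha>\<^sup>2)" for n k
    unfolding sq by simp
  have n\<alpha>: "cmod (of_real (1 / \<alpha>\<^sup>2)) = 1 / \<alpha>\<^sup>2"
    by (simp add: norm_divide norm_power)
  define G where "G k = ((\<Sum>r<m. g (int r) * of_real (pi / (real m * y k) * (1 + C r k)))
      - g 0 * of_real (1 / (y k)\<^sup>2)) / 2 * of_real (1 / \<alpha>\<^sup>2)" for k
  have col: "(\<lambda>n. a n * of_real (real (Suc n) ^ 0 / ((\<alpha> * real (Suc n))\<^sup>2 + (pi * real (Suc k))\<^sup>2))) sums G k" for k
    using even_quadratic_sums[of m g "y k", OF m per even y]
    unfolding Xy \<theta>_def[symmetric] C1 term_eq G_def a_def[symmetric] by (rule sums_mult2)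
  \<comment> \<open>Two regimes: for \<open>q > 0\<close> the weights in \<open>k\<close> are
    summable and bounded coefficients suffice; for \<open>q = 0\<close> the vanishing mean bounds
    the partial sums of \<open>g\<close>, and \<open>1 / (y k)^2\<close> takes over the role of the
    weights.\<close>
  obtain h where h: "summable h" and bound: "\<And>N k. cmod (\<Sum>n<N. a n *
      of_real (real (Suc n) ^ 0 / ((\<alpha> * real (Suc n))\<^sup>2 + (pi * real (Suc k))\<^sup>2))) / real (Suc k) ^ (2 * q) \<le> h k"
  proof (cases "q > 0")
    case True
    obtain B where B: "\<And>n. cmod (g n) \<le> B"
      using periodic_bounded[of m g, OF m per] by blast
    define B' where "B' = B * (\<Sum>n. 1 / real (Suc n) ^ 2) * (1 / \<alpha>\<^sup>2)"
    show ?thesis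
    proof (rule that)
      show "summable (\<lambda>k. B' * (1 / real (Suc k) ^ (2 * q)))"
        using True by (intro summable_mult summable_inverse_power) simp
      fix N k
      have "cmod (\<Sum>n<N. a n * of_real (1 / ((real (Suc n))\<^sup>2 + (y k)\<^sup>2))) * cmod (of_real (1 / \<alpha>\<^sup>2)) \<le> B'"
        unfolding B'_def n\<alpha> using B by (intro mult_right_mono bounded_partial_sums(2)) (auto simp: a_def)
      then have "cmod (\<Sum>n<N. a n * of_real (1 / ((real (Suc n))\<^sup>2 + (y k)\<^sup>2))) * cmod (of_real (1 / \<alpha>\<^sup>2))
          / real (Suc k) ^ (2 * q) \<le> B' / real (Suc k) ^ (2 * q)"
        by (intro divide_right_mono) auto
      then show "cmod (\<Sum>n<N. a n * of_real (real (Suc n) ^ 0 / ((\<alpha> * real (Suc n))\<^sup>2 + (pi * real (Suc k))\<^sup>2)))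
          / real (Suc k) ^ (2 * q) \<le> B' * (1 / real (Suc k) ^ (2 * q))"
        unfolding term_eq sum_distrib_right[symmetric] norm_mult by simp
    qed
  next
    case False
    then have "q = 0" "S = 0" using qS by auto
    obtain B where B: "\<And>N. cmod (\<Sum>n<N. a n) \<le> B" "B \<ge> 0"
      using periodic_partial_sums_bounded[of m g, OF m per] \<open>S = 0\<close> unfolding S_def a_def by blast
    show ?thesis
    proof (rule that)
      show "summable (\<lambda>k. B / pi\<^sup>2 * (1 / real (Suc k) ^ 2))"
        by (intro summable_mult summable_inverse_power) simp
      fix N k
      have "cmod (\<Sum>n<N. a n * of_real (1 / ((real (Suc n))\<^sup>2 + (y k)\<^sup>2))) * cmod (of_real (1 / \<alpha>\<^sup>2)) \<le> B / (y k)\<^sup>2 * (1 / \<alpha>\<^sup>2)"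
        unfolding n\<alpha> by (intro mult_right_mono even_partial_sums[OF B y]) auto
      also have "\<dots> = B / pi\<^sup>2 * (1 / real (Suc k) ^ 2)"
        using \<alpha> by (simp add: y_def power_divide power_mult_distrib del: of_nat_Suc)
      finally show "cmod (\<Sum>n<N. a n * of_real (real (Suc n) ^ 0 / ((\<alpha> * real (Suc n))\<^sup>2 + (pi * real (Suc k))\<^sup>2)))
          / real (Suc k) ^ (2 * q) \<le> B / pi\<^sup>2 * (1 / real (Suc k) ^ 2)"
        unfolding term_eq sum_distrib_right[symmetric] norm_mult \<open>q = 0\<close> by simp
    qed
  qed
  define Z where "Z j = (\<Sum>k. 1 / real (Suc k) ^ (2 * j))" for j
  have Z: "(\<lambda>k. 1 / real (Suc k) ^ (2 * Suc i)) sums Z (Suc i)" for i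
    unfolding Z_def by (intro summable_sums summable_inverse_power) simp
  have zeta: "zeta (2 * of_nat (Suc i)) = of_real (Z (Suc i))" for i
    using sums_unique2[OF zeta_sums sums_of_real[OF Z[of i]]] by (simp add: algebra_simps)
  have \<Lambda>: "(\<lambda>n. a n * of_real (1 / real (Suc n) ^ (2 * (q - j) + 2 - 0))) sums dirichlet_L (2 * of_nat q - 2 * of_nat j + 2) g"
    if "j \<le> q" for j
    using dirichlet_L_of_nat_sums[of m g "2 * (q - j) + 2", OF m per] that
    by (simp add: a_def of_nat_diff algebra_simps)
  define \<Lambda> where "\<Lambda> j = dirichlet_L (2 * of_nat q - 2 * of_nat j + 2) g" for j :: nat
  define W where "W n = (1 / 2 + 1 / (exp (2 * (\<alpha> * real (Suc n))) - 1)) / real (Suc n) ^ (2 * q + 1)" for n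
  define c where "c = \<alpha> * (- 1) ^ q * (\<alpha> / pi) ^ (2 * q)"
  define \<kappa> where "\<kappa> i = (- 1) ^ i * \<alpha> ^ (2 * i + 1) / pi ^ (2 * i + 2) * Z (Suc i)" for i
  define Gs where "Gs = (\<Sum>k. G k * of_real (1 / real (Suc k) ^ (2 * q)))"
  have W: "(\<lambda>n. a n * of_real (W n)) sums (of_real (1 / (2 * \<alpha>)) * \<Lambda> 0 + (\<Sum>i<q. of_real (\<kappa> i) * \<Lambda> (Suc i)) + of_real c * Gs)"
    unfolding W_def \<Lambda>_def c_def \<kappa>_def Gs_def
    using coth_dirichlet_series_sums[where \<epsilon> = 0, OF \<alpha> _ col bound h \<Lambda> Z] by simp
  have L1: "(\<lambda>n. a n * of_real (1 / real (Suc n) ^ (2 * q + 1))) sums dirichlet_L (2 * of_nat q + 1) g"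
    using dirichlet_L_of_nat_sums[of m g "2 * q + 1", OF m per] qS
    by (auto simp: a_def S_def algebra_simps)
  have lhs: "1/2 * dirichlet_L (2 * of_nat q + 1) g
        + (\<Sum>n. g (int (Suc n)) / of_real (real (Suc n) ^ (2*q+1) * (exp (2 * real (Suc n) * \<alpha>) - 1)))
      = of_real (1 / (2 * \<alpha>)) * \<Lambda> 0 + (\<Sum>i<q. of_real (\<kappa> i) * \<Lambda> (Suc i)) + of_real c * Gs"
  proof -
    have "a n * of_real (W n) - 1/2 * (a n * of_real (1 / real (Suc n) ^ (2 * q + 1)))
        = g (int (Suc n)) / of_real (real (Suc n) ^ (2*q+1) * (exp (2 * real (Suc n) * \<alpha>) - 1))" for n
    proof -
      have "W n = 1/2 * (1 / real (Suc n) ^ (2 * q + 1)) + 1 / (real (Suc n) ^ (2*q+1) * (exp (2 * real (Suc n) * \<alpha>) - 1))"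
        by (simp add: W_def add_divide_distrib mult_ac del: of_nat_Suc)
      then have "a n * of_real (W n) - 1/2 * (a n * of_real (1 / real (Suc n) ^ (2 * q + 1)))
        = a n * of_real (1 / (real (Suc n) ^ (2*q+1) * (exp (2 * real (Suc n) * \<alpha>) - 1)))"
        by (simp add: distrib_left)
      then show ?thesis by (simp add: a_def)
    qed
    with sums_diff[OF W sums_mult[OF L1, of "1/2"]] show ?thesis
      by (simp add: sums_iff)
  qed
  have Gs: "Gs = of_real (1 / (2 * \<alpha>)) / of_nat m * ((\<Sum>r<m. g (int r) * of_real (V r)) + U)
      - of_real (Z (Suc q) / (2 * pi\<^sup>2)) * g 0"
  proof -
    \<comment> \<open>For \<open>q = 0\<close> every summand is 0 because \<open>S = 0\<close>, in
      accordance with reading the term with \<open>zeta 1\<close> as 0.\<close>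
    have zU: "(\<lambda>k. S * of_real (1 / real (Suc k) ^ (2 * q + 1))) sums U"
    proof (cases "q = 0")
      case True
      then show ?thesis using qS by (simp add: U_def)
    next
      case False
      then show ?thesis
        using sums_mult[OF zeta_sums[of "2 * q + 1"], of S] by (simp add: U_def algebra_simps)
    qed
    have "(\<lambda>k. of_real (1 / (2 * \<alpha>)) / of_nat m * ((\<Sum>r<m. g (int r) * of_real (C r k / real (Suc k) ^ (2*q+1)))
          + S * of_real (1 / real (Suc k) ^ (2 * q + 1)))
        - of_real (1 / real (Suc k) ^ (2 * Suc q)) * of_real (1 / (2 * pi\<^sup>2)) * g 0)
      sums (of_real (1 / (2 * \<alpha>)) / of_nat m * ((\<Sum>r<m. g (int r) * of_real (V r)) + U)
        - of_real (Z (Suc q)) * of_real (1 / (2 * pi\<^sup>2)) * g 0)"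
      by (intro sums_diff sums_add sums_mult sums_mult2 sums_sum sums_of_real V zU Z)
    moreover have "of_real (1 / (2 * \<alpha>)) / of_nat m * ((\<Sum>r<m. g (int r) * of_real (C r k / real (Suc k) ^ (2*q+1)))
          + S * of_real (1 / real (Suc k) ^ (2 * q + 1)))
        - of_real (1 / real (Suc k) ^ (2 * Suc q)) * of_real (1 / (2 * pi\<^sup>2)) * g 0
        = G k * of_real (1 / real (Suc k) ^ (2 * q))" for k
    proof -
      define K where "K = real (Suc k)"
      have K: "K > 0" by (simp add: K_def)
      define P where "P = (\<Sum>r<m. g (int r) * of_real (1 + C r k))"
      have 1: "(\<Sum>r<m. g (int r) * of_real (C r k / K ^ (2*q+1))) + S * of_real (1 / K ^ (2 * q + 1))
          = P * of_real (1 / K ^ (2 * q + 1))"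
        by (simp add: P_def S_def sum_divide_distrib sum.distrib distrib_left add.commute add_divide_distrib)
      have 2: "G k = (P * of_real (\<alpha> / (real m * K))
          - g 0 * of_real (\<alpha>\<^sup>2 / (pi\<^sup>2 * K\<^sup>2))) / 2 * of_real (1 / \<alpha>\<^sup>2)"
      proof -
        have "pi / (real m * y k) = \<alpha> / (real m * K)" "1 / (y k)\<^sup>2 = \<alpha>\<^sup>2 / (pi\<^sup>2 * K\<^sup>2)"
          by (simp_all add: y_def K_def power_divide power_mult_distrib del: of_nat_Suc)
        then show ?thesis
          by (simp only: P_def G_def of_real_mult[of "\<alpha> / (real m * K)"] mult.commute[of "of_real (\<alpha> / (real m * K))"]
               mult.assoc[symmetric] sum_distrib_right)
      qed
      show ?thesis
        unfolding K_def[symmetric] 1 2 using \<alpha> m K by (simp add: field_simps power2_eq_square)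
    qed
    ultimately show ?thesis
      unfolding Gs_def by (simp add: sums_iff)
  qed
  define p where "p = \<alpha> powi (- int q)"
  have \<beta>_eq: "\<beta> = pi\<^sup>2 / \<alpha>" using \<alpha> \<alpha>\<beta> by (simp add: field_simps)
  have p: "p = 1 / \<alpha> ^ q" by (simp add: p_def power_int_minus inverse_eq_divide)
  have \<beta>_powi: "\<beta> powi (- int j) = \<alpha> ^ j / pi ^ (2 * j)" for j
    by (simp add: power_int_minus inverse_eq_divide \<beta>_eq power_divide power_mult)
  have \<alpha>_powi: "\<alpha> powi (int j - int q - 1) = \<alpha> ^ j / \<alpha> ^ Suc q" for j
  proof -
    have "\<alpha> \<noteq> 0 \<or> int j \<noteq> int (Suc q)" using \<alpha> by simp
    moreover have "int j - int q - 1 = int j - int (Suc q)" by simp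
    ultimately show ?thesis by (simp only: power_int_diff power_int_of_nat)
  qed
  \<comment> \<open>The passage from \<alpha> to \<beta> in the prefactor:
    \<open>(\<alpha> / pi) ^ (2 * q)\<close> divided by \<open>\<alpha> ^ q\<close> is
    \<open>\<beta>\<close> to the power \<open>- q\<close>.\<close>
  have pc: "p * c / \<alpha> = (- \<beta>) powi (- int q)"
  proof -
    have "(- \<beta>) powi (- int q) = (- 1) ^ q * (\<beta> powi (- int q))"
      by (cases "even q") (simp_all add: power_int_minus inverse_eq_divide)
    then show ?thesis
      unfolding p c_def \<beta>_powi using \<alpha> by (simp add: power_divide mult_2 power_add)
  qed
  define f where "f j = (-1) ^ (j+1) * complex_of_real (\<alpha> powi (int j - int q - 1) * \<beta> powi (- int j)) *
              zeta (2 * of_nat j) * \<Lambda> j" for j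
  have "(\<Sum>j=0..q+1. f j) = f 0 + (\<Sum>i<q. f (Suc i)) + f (Suc q)"
    unfolding sum_atLeast0_atMost_split_first by simp
  also have "f 0 = of_real (p * (1 / (2 * \<alpha>))) * \<Lambda> 0"
    unfolding f_def \<alpha>_powi \<beta>_powi p using \<alpha> by (simp add: zeta_0 mult_ac)
  also have "(\<Sum>i<q. f (Suc i)) = (\<Sum>i<q. of_real (p * \<kappa> i) * \<Lambda> (Suc i))"
  proof (rule sum.cong[OF refl])
    fix i
    have "\<alpha> ^ Suc i / \<alpha> ^ Suc q * (\<alpha> ^ Suc i / pi ^ (2 * Suc i)) = p * (\<alpha> ^ (2 * i + 1) / pi ^ (2 * i + 2))"
      unfolding p using \<alpha> by (simp add: mult_2 power_add)
    then show "f (Suc i) = of_real (p * \<kappa> i) * \<Lambda> (Suc i)"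
      unfolding f_def \<alpha>_powi \<beta>_powi zeta \<kappa>_def by (simp only:) simp
  qed
  \<comment> \<open>The last summand lies beyond the geometric expansion. It matches the
    contribution of \<open>n = 0\<close> to \<open>Gs\<close>, once \<open>L(0, g)\<close> is
    replaced by \<open>- g 0 / 2\<close>.\<close>
  also have "f (Suc q) = - of_real (p * c * (Z (Suc q) / (2 * pi\<^sup>2))) * g 0"
  proof -
    have "\<Lambda> (Suc q) = - g 0 / 2"
      using dirichlet_L_0[of m g, OF m per even] by (simp add: \<Lambda>_def algebra_simps)
    moreover define x where "x = \<alpha> ^ Suc q / \<alpha> ^ Suc q * (\<alpha> ^ Suc q / pi ^ (2 * Suc q))"
    ultimately have "f (Suc q) = of_real x * (- 1) ^ q * of_real (Z (Suc q)) * (- g 0 / 2)"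
      unfolding f_def \<alpha>_powi \<beta>_powi zeta by (simp add: mult_ac)
    also have "of_real x * (- 1) ^ q = complex_of_real (x * (- 1) ^ q)"
      by simp
    also have "x * (- 1) ^ q = p * c / pi\<^sup>2"
      unfolding x_def p c_def using \<alpha> by (simp add: mult_2 power_add power_divide power2_eq_square) (simp add: mult_ac)
    finally show ?thesis by simp
  qed
  finally have sum_f: "(\<Sum>j=0..q+1. f j) = of_real (p * (1 / (2 * \<alpha>))) * \<Lambda> 0
     + (\<Sum>i<q. of_real (p * \<kappa> i) * \<Lambda> (Suc i)) + - of_real (p * c * (Z (Suc q) / (2 * pi\<^sup>2))) * g 0" .
  have U': "(if q = 0 then 0 else period_mean m g * zeta (2 * of_nat q + 1)) = U / of_nat m"
    by (simp add: U_def M)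
  have V': "(\<Sum>k=0..<m. g (int k) *
              of_real (\<Sum>n. (cos (2 * pi * real k / real m) - exp (- 2 * real (Suc n) * \<beta> / real m)) /
                (cosh (2 * real (Suc n) * \<beta> / real m) - cos (2 * pi * real k / real m)) /
                real (Suc n) ^ (2*q+1))) = (\<Sum>r<m. g (int r) * of_real (V r))"
    unfolding V_def C_def X_def \<theta>_def atLeast0LessThan mult_minus_left minus_divide_left ..
  show ?thesis
    unfolding lhs U' V' p_def[symmetric] \<Lambda>_def[symmetric] f_def[symmetric] sum_f pc[symmetric] Gs
    using m \<alpha> by (simp add: field_simps sum_distrib_left)
qed

lemma dirichlet_identity_odd:
  fixes m q :: nat and g :: "int \<Rightarrow> complex" and \<alpha> \<beta> :: real
  assumes m: "m > 0" and per: "\<And>n. g (n + int m) = g n"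
    and \<alpha>: "\<alpha> > 0" and \<beta>: "\<beta> > 0" and \<alpha>\<beta>: "\<alpha> * \<beta> = pi\<^sup>2"
    and odd: "\<And>n. g (- n) = - g n" and q: "q > 0"
  shows "of_real (\<alpha> powr (- real q + 1/2)) *
         (1/2 * dirichlet_L (2 * of_nat q) g
          + (\<Sum>n. g (int (Suc n)) /
                of_real (real (Suc n) ^ (2*q) * (exp (2 * real (Suc n) * \<alpha>) - 1))))
       = 1/2 * (-1) ^ q * of_real (\<beta> powr (- real q + 1/2)) / of_nat m *
           (\<Sum>k=1..<m. g (int k) * of_real (sin (2 * pi * real k / real m)) *
              of_real (\<Sum>n. 1 / (real (Suc n) ^ (2*q) *
                (cosh (2 * real (Suc n) * \<beta> / real m) - cos (2 * pi * real k / real m)))))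
         + (\<Sum>j=0..q. (-1) ^ (j+1) *
              of_real (\<alpha> powr (real j - 1/2 - real q) * \<beta> powi (- int j)) *
              zeta (2 * of_nat j) * dirichlet_L (2 * of_nat q - 2 * of_nat j + 1) g)"
proof -
  define a where "a n = g (int (Suc n))" for n
  define X where "X k = 2 * real (Suc k) * \<beta> / real m" for k
  define \<theta> where "\<theta> r = 2 * pi * real r / real m" for r
  define V where "V r = (\<Sum>k. 1 / (real (Suc k) ^ (2*q) * (cosh (X k) - cos (\<theta> r))))" for r
  define y where "y k = pi * real (Suc k) / \<alpha>" for k
  have S: "(\<Sum>r<m. g (int r)) = 0"
    using odd_periodic_sum_eq_0[of g m, OF per odd] .
  have y: "y k > 0" for k using \<alpha> by (simp add: y_def)
  have Xy: "2 * pi * y k / real m = X k" for k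
    unfolding X_def y_def using dual_parameter_scaling[OF \<alpha> \<alpha>\<beta>] .
  have V: "(\<lambda>k. 1 / (real (Suc k) ^ (2*q) * (cosh (X k) - cos (\<theta> r)))) sums V r" for r
  proof -
    have "summable (\<lambda>k. 1 / (cosh (2 * \<beta> / real m * real (Suc k)) - cos (\<theta> r)) / real (Suc k) ^ (2*q))"
      using \<beta> m by (intro summable_over_cosh_minus_cos[where C = 1]) auto
    moreover have "2 * \<beta> / real m * real (Suc k) = X k" for k by (simp add: X_def)
    ultimately show ?thesis unfolding V_def by (simp add: summable_sums mult.commute del: of_nat_Suc)
  qed
  have sq: "(\<alpha> * N)\<^sup>2 + (pi * real (Suc k))\<^sup>2 = \<alpha>\<^sup>2 * (N\<^sup>2 + (y k)\<^sup>2)" for N k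
    using \<alpha> by (simp add: y_def distrib_left power_mult_distrib power_divide del: of_nat_Suc)
  have term_eq: "a n * of_real (real (Suc n) ^ 1 / ((\<alpha> * real (Suc n))\<^sup>2 + (pi * real (Suc k))\<^sup>2))
      = a n * of_real (real (Suc n) / ((real (Suc n))\<^sup>2 + (y k)\<^sup>2)) * of_real (1 / \<alpha>\<^sup>2)" for n k
    unfolding sq by simp
  have n\<alpha>: "cmod (of_real (1 / \<alpha>\<^sup>2)) = 1 / \<alpha>\<^sup>2"
    by (simp add: norm_divide norm_power)
  define G where "G k = (\<Sum>r<m. g (int r) * of_real (pi / real m * (sin (\<theta> r) / (cosh (X k) - cos (\<theta> r))))) / 2
      * of_real (1 / \<alpha>\<^sup>2)" for k
  have col: "(\<lambda>n. a n * of_real (real (Suc n) ^ 1 / ((\<alpha> * real (Suc n))\<^sup>2 + (pi * real (Suc k))\<^sup>2))) sums G k" for k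
    using odd_quadratic_sums[of m g "y k", OF m per odd y]
    unfolding Xy \<theta>_def[symmetric] term_eq G_def a_def[symmetric] by (rule sums_mult2)
  obtain B where B: "\<And>N. cmod (\<Sum>n<N. a n) \<le> B" "B \<ge> 0"
    using periodic_partial_sums_bounded[of m g, OF m per S] unfolding a_def by blast
  \<comment> \<open>The bound for the odd kernel does not decay in \<open>k\<close>, so
    \<open>q > 0\<close> is what makes the majorant summable.\<close>
  have h: "summable (\<lambda>k. 2 * B * (1 / \<alpha>\<^sup>2) * (1 / real (Suc k) ^ (2 * q)))"
    using q by (intro summable_mult summable_inverse_power) simp
  have bound: "cmod (\<Sum>n<N. a n * of_real (real (Suc n) ^ 1 / ((\<alpha> * real (Suc n))\<^sup>2 + (pi * real (Suc k))\<^sup>2)))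
      / real (Suc k) ^ (2 * q) \<le> 2 * B * (1 / \<alpha>\<^sup>2) * (1 / real (Suc k) ^ (2 * q))" for N k
  proof -
    have "cmod (\<Sum>n<N. a n * of_real (real (Suc n) / ((real (Suc n))\<^sup>2 + (y k)\<^sup>2))) * cmod (of_real (1 / \<alpha>\<^sup>2))
        \<le> 2 * B * (1 / \<alpha>\<^sup>2)"
      unfolding n\<alpha> by (intro mult_right_mono odd_partial_sums(2)[OF B]) auto
    then have "cmod (\<Sum>n<N. a n * of_real (real (Suc n) / ((real (Suc n))\<^sup>2 + (y k)\<^sup>2))) * cmod (of_real (1 / \<alpha>\<^sup>2))
        / real (Suc k) ^ (2 * q) \<le> 2 * B * (1 / \<alpha>\<^sup>2) / real (Suc k) ^ (2 * q)"
      by (intro divide_right_mono) auto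
    then show ?thesis
      unfolding term_eq sum_distrib_right[symmetric] norm_mult by simp
  qed
  define Z where "Z j = (\<Sum>k. 1 / real (Suc k) ^ (2 * j))" for j
  have Z: "(\<lambda>k. 1 / real (Suc k) ^ (2 * Suc i)) sums Z (Suc i)" for i
    unfolding Z_def by (intro summable_sums summable_inverse_power) simp
  have zeta: "zeta (2 * of_nat (Suc i)) = of_real (Z (Suc i))" for i
    using sums_unique2[OF zeta_sums sums_of_real[OF Z[of i]]] by (simp add: algebra_simps)
  \<comment> \<open>For \<open>j = q\<close> the exponent is 1, and convergence rests on the
    vanishing sum of \<open>g\<close> over a period.\<close>
  have \<Lambda>: "(\<lambda>n. a n * of_real (1 / real (Suc n) ^ (2 * (q - j) + 2 - 1))) sums dirichlet_L (2 * of_nat q - 2 * of_nat j + 1) g"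
    if "j \<le> q" for j
    using dirichlet_L_of_nat_sums[of m g "2 * (q - j) + 1", OF m per] that S
    by (simp add: a_def of_nat_diff algebra_simps)
  define \<Lambda> where "\<Lambda> j = dirichlet_L (2 * of_nat q - 2 * of_nat j + 1) g" for j :: nat
  define W where "W n = (1 / 2 + 1 / (exp (2 * (\<alpha> * real (Suc n))) - 1)) / real (Suc n) ^ (2 * q)" for n
  define c where "c = \<alpha> * (- 1) ^ q * (\<alpha> / pi) ^ (2 * q)"
  define \<kappa> where "\<kappa> i = (- 1) ^ i * \<alpha> ^ (2 * i + 1) / pi ^ (2 * i + 2) * Z (Suc i)" for i
  define Gs where "Gs = (\<Sum>k. G k * of_real (1 / real (Suc k) ^ (2 * q)))"
  have W: "(\<lambda>n. a n * of_real (W n)) sums (of_real (1 / (2 * \<alpha>)) * \<Lambda> 0 + (\<Sum>i<q. of_real (\<kappa> i) * \<Lambda> (Suc i)) + of_real c * Gs)"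
    unfolding W_def \<Lambda>_def c_def \<kappa>_def Gs_def
    using coth_dirichlet_series_sums[where \<epsilon> = 1, OF \<alpha> _ col bound h \<Lambda> Z] by simp
  have L1: "(\<lambda>n. a n * of_real (1 / real (Suc n) ^ (2 * q))) sums dirichlet_L (2 * of_nat q) g"
    using dirichlet_L_of_nat_sums[of m g "2 * q", OF m per] q
    by (auto simp: a_def algebra_simps)
  have lhs: "1/2 * dirichlet_L (2 * of_nat q) g
        + (\<Sum>n. g (int (Suc n)) / of_real (real (Suc n) ^ (2*q) * (exp (2 * real (Suc n) * \<alpha>) - 1)))
      = of_real (1 / (2 * \<alpha>)) * \<Lambda> 0 + (\<Sum>i<q. of_real (\<kappa> i) * \<Lambda> (Suc i)) + of_real c * Gs"
  proof -
    have "a n * of_real (W n) - 1/2 * (a n * of_real (1 / real (Suc n) ^ (2 * q)))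
        = g (int (Suc n)) / of_real (real (Suc n) ^ (2*q) * (exp (2 * real (Suc n) * \<alpha>) - 1))" for n
    proof -
      have "W n = 1/2 * (1 / real (Suc n) ^ (2 * q)) + 1 / (real (Suc n) ^ (2*q) * (exp (2 * real (Suc n) * \<alpha>) - 1))"
        by (simp add: W_def add_divide_distrib mult_ac del: of_nat_Suc)
      then have "a n * of_real (W n) - 1/2 * (a n * of_real (1 / real (Suc n) ^ (2 * q)))
        = a n * of_real (1 / (real (Suc n) ^ (2*q) * (exp (2 * real (Suc n) * \<alpha>) - 1)))"
        by (simp add: distrib_left)
      then show ?thesis by (simp add: a_def)
    qed
    with sums_diff[OF W sums_mult[OF L1, of "1/2"]] show ?thesis
      by (simp add: sums_iff)
  qed
  have Gs: "Gs = of_real (pi / (2 * \<alpha>\<^sup>2 * real m)) * (\<Sum>r<m. g (int r) * of_real (sin (\<theta> r)) * of_real (V r))"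
  proof -
    have "(\<lambda>k. of_real (pi / (2 * \<alpha>\<^sup>2 * real m)) * (\<Sum>r<m. g (int r) * of_real (sin (\<theta> r)) *
          of_real (1 / (real (Suc k) ^ (2*q) * (cosh (X k) - cos (\<theta> r))))))
      sums (of_real (pi / (2 * \<alpha>\<^sup>2 * real m)) * (\<Sum>r<m. g (int r) * of_real (sin (\<theta> r)) * of_real (V r)))"
      by (intro sums_mult sums_sum sums_of_real V)
    moreover have "of_real (pi / (2 * \<alpha>\<^sup>2 * real m)) * (\<Sum>r<m. g (int r) * of_real (sin (\<theta> r)) *
          of_real (1 / (real (Suc k) ^ (2*q) * (cosh (X k) - cos (\<theta> r)))))
        = G k * of_real (1 / real (Suc k) ^ (2 * q))" for k
      unfolding G_def sum_divide_distrib sum_distrib_right sum_distrib_left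
      by (intro sum.cong refl) (simp add: mult_ac del: of_nat_Suc)
    ultimately show ?thesis
      unfolding Gs_def by (simp add: sums_iff)
  qed
  \<comment> \<open>With \<open>s\<close> as variable the half-integral powers of \<alpha> and
    \<beta> become rational expressions, as \<open>sqrt \<beta> = pi / s\<close>.\<close>
  define s where "s = sqrt \<alpha>"
  have s: "s > 0" "s\<^sup>2 = \<alpha>" using \<alpha> by (simp_all add: s_def)
  have \<beta>_eq: "\<beta> = pi\<^sup>2 / \<alpha>" using \<alpha> \<alpha>\<beta> by (simp add: field_simps)
  define p where "p = \<alpha> powr (- real q + 1/2)"
  have p: "p = s / \<alpha> ^ q"
    unfolding p_def using \<alpha> by (simp add: powr_diff powr_realpow s_def powr_half_sqrt)
  have \<beta>_powi: "\<beta> powi (- int j) = \<alpha> ^ j / pi ^ (2 * j)" for j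
    by (simp add: power_int_minus inverse_eq_divide \<beta>_eq power_divide power_mult)
  have \<alpha>_powr: "\<alpha> powr (real j - 1/2 - real q) = \<alpha> ^ j / (s * \<alpha> ^ q)" for j
    using \<alpha> by (simp add: powr_diff powr_realpow s_def powr_half_sqrt)
  have \<beta>_powr: "\<beta> powr (- real q + 1/2) = pi / s * (\<alpha> ^ q / pi ^ (2 * q))"
  proof -
    have "sqrt \<beta> = pi / s" by (simp add: \<beta>_eq real_sqrt_divide s_def)
    moreover have "\<beta> powr (- real q + 1/2) = sqrt \<beta> / \<beta> ^ q"
      using \<beta> by (simp add: powr_diff powr_realpow powr_half_sqrt)
    ultimately show ?thesis
      by (simp add: \<beta>_eq power_divide power_mult)
  qed
  have pc: "p * c * (pi / (2 * \<alpha>\<^sup>2 * real m)) = 1/2 * (-1) ^ q * \<beta> powr (- real q + 1/2) / real m"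
  proof -
    \<comment> \<open>Symbolic powers are replaced by variables, \<open>w\<close> for
      \<open>\<alpha> ^ q\<close> and \<open>P\<close> for \<open>pi ^ (2 * q)\<close>, which leaves
      an identity of rational functions.\<close>
    have "(s / w) * (\<alpha> * t * (w * w / P)) * (pi / (2 * \<alpha>\<^sup>2 * M)) = 1/2 * t * (pi / s * (w / P)) / M"
      if "w \<noteq> 0" "P \<noteq> 0" "M \<noteq> 0" for w t P M :: real
      unfolding s(2)[symmetric] using s(1) that by (simp add: divide_simps power2_eq_square)
    moreover have "(\<alpha> / pi) ^ (2 * q) = \<alpha> ^ q * \<alpha> ^ q / pi ^ (2 * q)"
      by (simp add: power_divide mult_2 power_add)
    moreover have "\<alpha> ^ q \<noteq> 0" "pi ^ (2 * q) \<noteq> 0" "real m \<noteq> 0"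
      using \<alpha> m by simp_all
    ultimately show ?thesis
      unfolding p c_def \<beta>_powr by (simp only: not_False_eq_True)
  qed
  define f where "f j = (-1) ^ (j+1) * complex_of_real (\<alpha> powr (real j - 1/2 - real q) * \<beta> powi (- int j)) *
              zeta (2 * of_nat j) * \<Lambda> j" for j
  have "(\<Sum>j=0..q. f j) = f 0 + (\<Sum>i<q. f (Suc i))"
    by (rule sum_atLeast0_atMost_split_first)
  also have "f 0 = of_real (p * (1 / (2 * \<alpha>))) * \<Lambda> 0"
  proof -
    have "1 / (s * \<alpha> ^ q) = p * (1 / \<alpha>)"
      unfolding p s(2)[symmetric] using s(1) by (simp add: power2_eq_square)
    then have "f 0 = - complex_of_real (p * (1 / \<alpha>)) * zeta 0 * \<Lambda> 0"
      unfolding f_def \<alpha>_powr \<beta>_powi by simp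
    then show ?thesis by (simp add: zeta_0)
  qed
  also have "(\<Sum>i<q. f (Suc i)) = (\<Sum>i<q. of_real (p * \<kappa> i) * \<Lambda> (Suc i))"
  proof (rule sum.cong[OF refl])
    fix i
    have "\<alpha> ^ Suc i / (s * \<alpha> ^ q) * (\<alpha> ^ Suc i / pi ^ (2 * Suc i)) = p * (\<alpha> ^ (2 * i + 1) / pi ^ (2 * i + 2))"
      unfolding p s(2)[symmetric] using s(1) by (simp add: mult_2 power_add power2_eq_square)
    then show "f (Suc i) = of_real (p * \<kappa> i) * \<Lambda> (Suc i)"
      unfolding f_def \<alpha>_powr \<beta>_powi zeta \<kappa>_def by (simp only:) simp
  qed
  finally have sum_f: "(\<Sum>j=0..q. f j) = of_real (p * (1 / (2 * \<alpha>))) * \<Lambda> 0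
     + (\<Sum>i<q. of_real (p * \<kappa> i) * \<Lambda> (Suc i))" .
  \<comment> \<open>The residue 0 may be added to the range, because its sine factor is 0.\<close>
  have V': "(\<Sum>k=1..<m. g (int k) * of_real (sin (2 * pi * real k / real m)) *
              of_real (\<Sum>n. 1 / (real (Suc n) ^ (2*q) *
                (cosh (2 * real (Suc n) * \<beta> / real m) - cos (2 * pi * real k / real m)))))
      = (\<Sum>r<m. g (int r) * of_real (sin (\<theta> r)) * of_real (V r))"
    unfolding V_def X_def \<theta>_def lessThan_atLeast0
    using m by (simp add: sum.atLeast_Suc_lessThan[of 0 m])
  have "of_real p * (of_real c * Gs) = 1/2 * (-1) ^ q * of_real (\<beta> powr (- real q + 1/2)) / of_nat m
      * (\<Sum>r<m. g (int r) * of_real (sin (\<theta> r)) * of_real (V r))"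
  proof -
    have "of_real p * (of_real c * Gs) = complex_of_real (p * c * (pi / (2 * \<alpha>\<^sup>2 * real m)))
      * (\<Sum>r<m. g (int r) * of_real (sin (\<theta> r)) * of_real (V r))"
      unfolding Gs by (simp only: of_real_mult mult.assoc)
    then show ?thesis unfolding pc by simp
  qed
  then show ?thesis
    unfolding lhs V' p_def[symmetric] \<Lambda>_def[symmetric] f_def[symmetric] sum_f
    by (simp add: distrib_left sum_distrib_left mult.assoc)
qed

theorem theorem2:
  fixes m q :: nat and g :: "int \<Rightarrow> complex" and \<alpha> \<beta> :: real
  assumes "m > 0"
    and "\<And>n. g (n + int m) = g n"
    and "\<alpha> > 0" and "\<beta> > 0" and "\<alpha> * \<beta> = pi\<^sup>2"
  shows
    "((\<forall>n. g (- n) = - g n) \<and> q > 0 \<longrightarrow>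
       of_real (\<alpha> powr (- real q + 1/2)) *
         (1/2 * dirichlet_L (2 * of_nat q) g
          + (\<Sum>n. g (int (Suc n)) /
                of_real (real (Suc n) ^ (2*q) * (exp (2 * real (Suc n) * \<alpha>) - 1))))
       = 1/2 * (-1) ^ q * of_real (\<beta> powr (- real q + 1/2)) / of_nat m *
           (\<Sum>k=1..<m. g (int k) * of_real (sin (2 * pi * real k / real m)) *
              of_real (\<Sum>n. 1 / (real (Suc n) ^ (2*q) *
                (cosh (2 * real (Suc n) * \<beta> / real m) - cos (2 * pi * real k / real m)))))
         + (\<Sum>j=0..q. (-1) ^ (j+1) *
              of_real (\<alpha> powr (real j - 1/2 - real q) * \<beta> powi (- int j)) *
              zeta (2 * of_nat j) * dirichlet_L (2 * of_nat q - 2 * of_nat j + 1) g))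
     \<and>
     ((\<forall>n. g (- n) = g n) \<and> (q > 0 \<or> period_mean m g = 0) \<longrightarrow>
       of_real (\<alpha> powi (- int q)) *
         (1/2 * dirichlet_L (2 * of_nat q + 1) g
          + (\<Sum>n. g (int (Suc n)) /
                of_real (real (Suc n) ^ (2*q+1) * (exp (2 * real (Suc n) * \<alpha>) - 1))))
       = 1/2 * of_real ((- \<beta>) powi (- int q)) / of_nat m *
           (\<Sum>k=0..<m. g (int k) *
              of_real (\<Sum>n. (cos (2 * pi * real k / real m) - exp (- 2 * real (Suc n) * \<beta> / real m)) /
                (cosh (2 * real (Suc n) * \<beta> / real m) - cos (2 * pi * real k / real m)) /
                real (Suc n) ^ (2*q+1)))
         + 1/2 * of_real ((- \<beta>) powi (- int q)) *
             (if q = 0 then 0 else period_mean m g * zeta (2 * of_nat q + 1))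
         + (\<Sum>j=0..q+1. (-1) ^ (j+1) *
              of_real (\<alpha> powi (int j - int q - 1) * \<beta> powi (- int j)) *
              zeta (2 * of_nat j) * dirichlet_L (2 * of_nat q - 2 * of_nat j + 2) g))"
  using dirichlet_identity_odd[of m g \<alpha> \<beta> q, OF assms] dirichlet_identity_even[of m g \<alpha> \<beta> q, OF assms]
  by blast

end
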